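(* If word equations with length constraints are undecidable, then the Diophantine problem is undecidable in every one-relator monoid $M=\langle A\mid w=1\rangle$ whose set $\Delta$ of minimal invertible pieces of $w$ satisfies the following three conditions: (C1) no word from $\Delta$ is a proper subword of any other word from $\Delta$; (C2) there exist distinct words $\gamma,\delta\in\Delta$ with a common first letter $a$; (C3) no word in $\Delta$ starts with $a^2$. On the other hand, if the Diophantine problem is decidable in some monoid of this kind, then word equations with length constraints are decidable. In particular, if the Diophantine problem is decidable for all one-relator monoids with torsion $\langle A\mid w^n=1\rangle$, with $n>1$, then word equations with length constraints are decidable.
   Context: $A$ denotes a finite alphabet. Minimal invertible pieces: for a monoid $M=\langle A\mid w=1\rangle$ the word $w$ decomposes uniquely as $w\equiv r_1\cdots r_k$ (equality as words) where each $r_i$ is a non-empty word representing an invertible element of $M$ and no proper non-empty prefix of $r_i$ represents an invertible element of $M$; $\Delta=\{r_1,\dots,r_k\}$. Word equations with length constraints: for a finite alphabet $S$, let $\mathsf{L}$ be the relation on the free monoid $S^*$ given by $\mathsf{L}(u,v)$ iff $|u|\le|v|$ ($|\cdot|$ is word length). A system of word equations with length constraints over $S^*$ is a finite system of equations $w_1=w_2$ together with finitely many constraints $\mathsf{L}(w_1,w_2)$, where $w_1,w_2$ are words over variables and letters of $S$; a solution is an assignment of words in $S^*$ to the variables making all the equations and all the inequalities $|w_1|\le|w_2|$ true. "Word equations with length constraints are decidable" means that, for finite alphabets $S$, the problem of deciding whether such a system over $S^*$ has a solution is decidable; otherwise they are undecidable. The Diophantine problem in a monoid is the algorithmic problem of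 deciding whether a given finite system of equations with coefficients in the monoid (given as words over the generators) has a solution. *)

theory Defs
  imports "HOL-Library.Nat_Bijection" "HOL-Library.Sublist" "HOL-Algebra.Group"
begin

section \<open>Decidability\<close>

text \<open>The total recursive functions, as unary functions on \<open>nat\<close>: several arguments are passed
  through the pairing function \<^const>\<open>prod_encode\<close>. Minimization is only applied to regular
  functions, so every function obtained is total; by Kleene's normal form theorem all total
  computable functions are obtained.\<close>

inductive recursive :: "(nat \<Rightarrow> nat) \<Rightarrow> bool" where
  zero: "recursive (\<lambda>_. 0)"
| succ: "recursive Suc"
| left: "recursive (\<lambda>n. fst (prod_decode n))"
| right: "recursive (\<lambda>n. snd (prod_decode n))"
| pair: "recursive f \<Longrightarrow> recursive g \<Longrightarrow> recursive (\<lambda>n. prod_encode (f n, g n))"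
| comp: "recursive f \<Longrightarrow> recursive g \<Longrightarrow> recursive (\<lambda>n. f (g n))"
| prim_rec: "recursive f \<Longrightarrow> recursive g \<Longrightarrow>
    recursive (\<lambda>n. rec_nat (f (fst (prod_decode n)))
      (\<lambda>m r. g (prod_encode (fst (prod_decode n), prod_encode (m, r)))) (snd (prod_decode n)))"
| minimize: "recursive f \<Longrightarrow> (\<And>n. \<exists>m. f (prod_encode (n, m)) = 0) \<Longrightarrow>
    recursive (\<lambda>n. LEAST m. f (prod_encode (n, m)) = 0)"

text \<open>A decision problem consists of a set \<open>I\<close> of instances, an encoding of instances as natural
  numbers and the property \<open>P\<close> to be decided. All encodings used below are assembled from the
  computable bijections of \<^theory>\<open>HOL-Library.Nat_Bijection\<close>.\<close>

definition decidable_problem :: "('i \<Rightarrow> nat) \<Rightarrow> 'i set \<Rightarrow> ('i \<Rightarrow> bool) \<Rightarrow> bool" where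
  "decidable_problem enc I P \<longleftrightarrow>
     (\<exists>f. recursive f \<and> (\<forall>x\<in>I. f (enc x) = (if P x then 1 else 0)))"


section \<open>Words over variables and letters\<close>

text \<open>Letters and variables are named by natural numbers; an alphabet is a finite set of
  natural numbers.\<close>

type_synonym word = "nat list"

datatype symbol = Var nat | Letter nat

type_synonym equation = "symbol list \<times> symbol list"

definition terms_over :: "nat set \<Rightarrow> symbol list set" where
  "terms_over A = lists (range Var \<union> Letter ` A)"

definition systems_over :: "nat set \<Rightarrow> equation list set" where
  "systems_over A = lists (terms_over A \<times> terms_over A)"

fun encode_symbol :: "symbol \<Rightarrow> nat" where
  "encode_symbol (Var x) = sum_encode (Inl x)"
| "encode_symbol (Letter a) = sum_encode (Inr a)"

definition encode_term :: "symbol list \<Rightarrow> nat" where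
  "encode_term t = list_encode (map encode_symbol t)"

definition encode_system :: "equation list \<Rightarrow> nat" where
  "encode_system E = list_encode (map (\<lambda>(l, r). prod_encode (encode_term l, encode_term r)) E)"


section \<open>Word equations with length constraints\<close>

fun subst_symbol :: "(nat \<Rightarrow> word) \<Rightarrow> symbol \<Rightarrow> word" where
  "subst_symbol \<sigma> (Var x) = \<sigma> x"
| "subst_symbol \<sigma> (Letter a) = [a]"

definition subst :: "(nat \<Rightarrow> word) \<Rightarrow> symbol list \<Rightarrow> word" where
  "subst \<sigma> t = concat (map (subst_symbol \<sigma>) t)"

text \<open>An instance is a pair \<open>(E, L)\<close> of a list of equations and a list of length constraints; a
  member \<open>(l, r)\<close> of \<open>L\<close> stands for the constraint that \<open>l\<close> is at most as long as \<open>r\<close>.\<close>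

definition length_system_solvable :: "nat set \<Rightarrow> equation list \<times> equation list \<Rightarrow> bool" where
  "length_system_solvable S = (\<lambda>(E, L).
     \<exists>\<sigma>. (\<forall>x. \<sigma> x \<in> lists S) \<and>
         (\<forall>(l, r)\<in>set E. subst \<sigma> l = subst \<sigma> r) \<and>
         (\<forall>(l, r)\<in>set L. length (subst \<sigma> l) \<le> length (subst \<sigma> r)))"

definition word_equations_with_length_decidable :: bool where
  "word_equations_with_length_decidable \<longleftrightarrow>
     (\<forall>S. finite S \<longrightarrow>
        decidable_problem (\<lambda>(E, L). prod_encode (encode_system E, encode_system L))
          (systems_over S \<times> systems_over S) (length_system_solvable S))"


section \<open>One-relator monoids\<close>

text \<open>The congruence on the free monoid over \<open>A\<close> generated by \<open>w = 1\<close>, for \<open>w\<close> a word over \<open>A\<close>.\<close>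

inductive_set relator_cong :: "nat set \<Rightarrow> word \<Rightarrow> (word \<times> word) set"
  for A :: "nat set" and w :: word where
  relator: "(w, []) \<in> relator_cong A w"
| refl: "u \<in> lists A \<Longrightarrow> (u, u) \<in> relator_cong A w"
| sym: "(u, v) \<in> relator_cong A w \<Longrightarrow> (v, u) \<in> relator_cong A w"
| trans: "(u, v) \<in> relator_cong A w \<Longrightarrow> (v, x) \<in> relator_cong A w \<Longrightarrow> (u, x) \<in> relator_cong A w"
| append: "(u, v) \<in> relator_cong A w \<Longrightarrow> (u', v') \<in> relator_cong A w \<Longrightarrow>
    (u @ u', v @ v') \<in> relator_cong A w"

definition represented :: "nat set \<Rightarrow> word \<Rightarrow> word \<Rightarrow> word set" where
  "represented A w u = relator_cong A w `` {u}"

definition one_relator_monoid :: "nat set \<Rightarrow> word \<Rightarrow> word set monoid" where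
  "one_relator_monoid A w =
     \<lparr>carrier = lists A // relator_cong A w,
      mult = (\<lambda>X Y. \<Union>x\<in>X. \<Union>y\<in>Y. represented A w (x @ y)),
      one = represented A w []\<rparr>"

lemma relator_cong_subset:
  assumes "w \<in> lists A" "(u, v) \<in> relator_cong A w"
  shows "u \<in> lists A \<and> v \<in> lists A"
  using assms(2) by induction (use assms(1) in auto)

lemma equiv_relator_cong:
  assumes "w \<in> lists A"
  shows "equiv (lists A) (relator_cong A w)"
proof (rule equivI)
  show "relator_cong A w \<subseteq> lists A \<times> lists A"
    using relator_cong_subset[OF assms] by auto
  show "refl_on (lists A) (relator_cong A w)"
    by (auto intro!: refl_onI relator_cong.refl)
  show "sym (relator_cong A w)" by (auto intro!: symI relator_cong.sym)
  show "trans (relator_cong A w)" by (rule transI) (rule relator_cong.trans)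
qed

lemma represented_eq_iff:
  assumes "w \<in> lists A" "u \<in> lists A" "v \<in> lists A"
  shows "represented A w u = represented A w v \<longleftrightarrow> (u, v) \<in> relator_cong A w"
  unfolding represented_def using eq_equiv_class_iff[OF equiv_relator_cong] assms by blast

lemma carrier_one_relator_monoid:
  "carrier (one_relator_monoid A w) = represented A w ` lists A"
  by (auto simp: one_relator_monoid_def represented_def quotient_def)

lemma one_one_relator_monoid: "\<one>\<^bsub>one_relator_monoid A w\<^esub> = represented A w []"
  by (simp add: one_relator_monoid_def)

lemma mult_represented:
  assumes "w \<in> lists A" "u \<in> lists A" "v \<in> lists A"
  shows "represented A w u \<otimes>\<^bsub>one_relator_monoid A w\<^esub> represented A w v = represented A w (u @ v)"
proof -
  have "represented A w (x @ y) = represented A w (u @ v)"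
    if "x \<in> represented A w u" "y \<in> represented A w v" for x y
  proof -
    have "(u @ v, x @ y) \<in> relator_cong A w"
      using that by (auto simp: represented_def intro: relator_cong.append)
    then show ?thesis
      unfolding represented_def by (metis equiv_class_eq equiv_relator_cong assms(1))
  qed
  moreover have "represented A w u \<noteq> {}" "represented A w v \<noteq> {}"
    using assms by (auto simp: represented_def intro: relator_cong.refl)
  ultimately show ?thesis
    by (simp add: one_relator_monoid_def cong: SUP_cong)
qed

lemma carrier_one_relator_monoidE:
  assumes "x \<in> carrier (one_relator_monoid A w)"
  obtains u where "u \<in> lists A" "x = represented A w u"
  using assms unfolding carrier_one_relator_monoid by (rule imageE)

lemma represented_in_carrier:
  "u \<in> lists A \<Longrightarrow> represented A w u \<in> carrier (one_relator_monoid A w)"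
  unfolding carrier_one_relator_monoid by (rule imageI)

lemma monoid_one_relator_monoid:
  assumes "w \<in> lists A"
  shows "monoid (one_relator_monoid A w)"
proof (rule monoidI)
  note mult = mult_represented[OF assms]
  fix x y assume x: "x \<in> carrier (one_relator_monoid A w)"
    and y: "y \<in> carrier (one_relator_monoid A w)"
  obtain u where u: "u \<in> lists A" "x = represented A w u"
    using x by (rule carrier_one_relator_monoidE)
  obtain v where v: "v \<in> lists A" "y = represented A w v"
    using y by (rule carrier_one_relator_monoidE)
  have uv: "u @ v \<in> lists A" using u(1) v(1) by simp
  show "x \<otimes>\<^bsub>one_relator_monoid A w\<^esub> y \<in> carrier (one_relator_monoid A w)"
    unfolding u(2) v(2) mult[OF u(1) v(1)] using uv by (rule represented_in_carrier)
  show "\<one>\<^bsub>one_relator_monoid A w\<^esub> \<otimes>\<^bsub>one_relator_monoid A w\<^esub> x = x"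
    unfolding u(2) one_one_relator_monoid mult[OF lists.Nil u(1)] by simp
  show "x \<otimes>\<^bsub>one_relator_monoid A w\<^esub> \<one>\<^bsub>one_relator_monoid A w\<^esub> = x"
    unfolding u(2) one_one_relator_monoid mult[OF u(1) lists.Nil] by simp
  fix z assume z: "z \<in> carrier (one_relator_monoid A w)"
  obtain t where t: "t \<in> lists A" "z = represented A w t"
    using z by (rule carrier_one_relator_monoidE)
  have vt: "v @ t \<in> lists A" using v(1) t(1) by simp
  show "x \<otimes>\<^bsub>one_relator_monoid A w\<^esub> y \<otimes>\<^bsub>one_relator_monoid A w\<^esub> z =
      x \<otimes>\<^bsub>one_relator_monoid A w\<^esub> (y \<otimes>\<^bsub>one_relator_monoid A w\<^esub> z)"
    unfolding u(2) v(2) t(2) mult[OF u(1) v(1)] mult[OF v(1) t(1)] mult[OF uv t(1)] mult[OF u(1) vt]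
    by simp
next
  show "\<one>\<^bsub>one_relator_monoid A w\<^esub> \<in> carrier (one_relator_monoid A w)"
    unfolding one_one_relator_monoid using lists.Nil by (rule represented_in_carrier)
qed


section \<open>The Diophantine problem\<close>

fun eval_symbol :: "nat set \<Rightarrow> word \<Rightarrow> (nat \<Rightarrow> word set) \<Rightarrow> symbol \<Rightarrow> word set" where
  "eval_symbol A w \<sigma> (Var x) = \<sigma> x"
| "eval_symbol A w \<sigma> (Letter a) = represented A w [a]"

definition eval_term :: "nat set \<Rightarrow> word \<Rightarrow> (nat \<Rightarrow> word set) \<Rightarrow> symbol list \<Rightarrow> word set" where
  "eval_term A w \<sigma> t =
     foldr (\<lambda>s g. eval_symbol A w \<sigma> s \<otimes>\<^bsub>one_relator_monoid A w\<^esub> g) t \<one>\<^bsub>one_relator_monoid A w\<^esub>"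

definition system_solvable :: "nat set \<Rightarrow> word \<Rightarrow> equation list \<Rightarrow> bool" where
  "system_solvable A w E \<longleftrightarrow>
     (\<exists>\<sigma>. (\<forall>x. \<sigma> x \<in> carrier (one_relator_monoid A w)) \<and>
         (\<forall>(l, r)\<in>set E. eval_term A w \<sigma> l = eval_term A w \<sigma> r))"

definition diophantine_problem_decidable :: "nat set \<Rightarrow> word \<Rightarrow> bool" where
  "diophantine_problem_decidable A w \<longleftrightarrow>
     decidable_problem encode_system (systems_over A) (system_solvable A w)"


section \<open>Minimal invertible pieces\<close>

definition invertible :: "nat set \<Rightarrow> word \<Rightarrow> word \<Rightarrow> bool" where
  "invertible A w u \<longleftrightarrow> represented A w u \<in> Units (one_relator_monoid A w)"

definition minimal_invertible :: "nat set \<Rightarrow> word \<Rightarrow> word \<Rightarrow> bool" where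
  "minimal_invertible A w r \<longleftrightarrow>
     r \<noteq> [] \<and> invertible A w r \<and> (\<forall>p. p \<noteq> [] \<longrightarrow> strict_prefix p r \<longrightarrow> \<not> invertible A w p)"

definition minimal_pieces :: "nat set \<Rightarrow> word \<Rightarrow> word set" where
  "minimal_pieces A w =
     set (THE rs. concat rs = w \<and> (\<forall>r\<in>set rs. minimal_invertible A w r))"

lemma minimal_invertible_prefix_unique:
  assumes "minimal_invertible A w r" "minimal_invertible A w r'" "r @ u = r' @ u'"
  shows "r = r'"
proof -
  have "prefix r (r' @ u')" "prefix r' (r' @ u')" by (metis assms(3) prefixI, simp)
  then consider "prefix r r'" | "prefix r' r" using prefix_same_cases by blast
  then show ?thesis
    using assms(1,2) unfolding minimal_invertible_def strict_prefix_def by metis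
qed

lemma decomposition_unique:
  assumes "concat rs = concat rs'"
    "\<forall>r\<in>set rs. minimal_invertible A w r" "\<forall>r\<in>set rs'. minimal_invertible A w r"
  shows "rs = rs'"
  using assms
proof (induction rs arbitrary: rs')
  case Nil
  then show ?case by (cases rs') (auto simp: minimal_invertible_def)
next
  case (Cons r rs)
  have "rs' \<noteq> []"
    using Cons.prems(1,2) by (force simp: minimal_invertible_def)
  then obtain r' rest where rs': "rs' = r' # rest" by (cases rs') simp_all
  have "r = r'"
    using Cons.prems minimal_invertible_prefix_unique[of A w r r' "concat rs" "concat rest"]
    by (simp add: rs')
  moreover have "rs = rest"
    using Cons.prems \<open>r = r'\<close> by (intro Cons.IH) (simp_all add: rs')
  ultimately show ?case by (simp add: rs')
qed

lemma (in monoid) Units_right_factor: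
  assumes "x \<in> Units G" "x \<otimes> y \<in> Units G" "y \<in> carrier G"
  shows "y \<in> Units G"
proof -
  have "inv x \<otimes> (x \<otimes> y) \<in> Units G"
    using Units_m_closed[OF Units_inv_Units[OF assms(1)] assms(2)] .
  moreover have "inv x \<otimes> (x \<otimes> y) = (inv x \<otimes> x) \<otimes> y"
    by (rule m_assoc[symmetric]) (use assms in \<open>auto intro: Units_closed\<close>)
  ultimately show ?thesis using assms by simp
qed

lemma decomposition_exists:
  assumes "w \<in> lists A" "u \<in> lists A" "invertible A w u"
  shows "\<exists>rs. concat rs = u \<and> (\<forall>r\<in>set rs. minimal_invertible A w r)"
  using assms(2,3)
proof (induction u rule: length_induct)
  case (1 u)
  interpret M: monoid "one_relator_monoid A w"
    by (rule monoid_one_relator_monoid[OF assms(1)])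
  show ?case
  proof (cases "u = []")
    case True
    then show ?thesis by (intro exI[of _ "[]"]) simp
  next
    case False
    define P where "P r \<longleftrightarrow> r \<noteq> [] \<and> prefix r u \<and> invertible A w r" for r
    have "P u" using False 1 by (simp add: P_def)
    then obtain r where r: "P r" "\<And>q. P q \<Longrightarrow> length r \<le> length q"
      using ex_has_least_nat[of P u length] by blast
    then obtain v where u: "u = r @ v" by (auto simp: P_def prefix_def)
    have min: "minimal_invertible A w r"
      unfolding minimal_invertible_def
    proof (intro conjI allI impI notI)
      fix p assume p: "p \<noteq> []" "strict_prefix p r" "invertible A w p"
      then have "prefix p u"
        using r(1) by (auto simp: P_def strict_prefix_def intro: prefix_order.trans)
      with p have "P p" by (simp add: P_def)
      from r(2)[OF this] show False using prefix_length_less[OF p(2)] by simp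
    qed (use r(1) in \<open>auto simp: P_def\<close>)
    have rv: "r \<in> lists A" "v \<in> lists A" using 1 u by auto
    have "represented A w r \<in> Units (one_relator_monoid A w)"
      using r by (simp add: P_def invertible_def)
    moreover have "represented A w r \<otimes>\<^bsub>one_relator_monoid A w\<^esub> represented A w v
        \<in> Units (one_relator_monoid A w)"
      using 1(3) u rv mult_represented[OF assms(1)] by (simp add: invertible_def)
    moreover have "represented A w v \<in> carrier (one_relator_monoid A w)"
      using rv by (simp add: carrier_one_relator_monoid)
    ultimately have "represented A w v \<in> Units (one_relator_monoid A w)"
      by (rule M.Units_right_factor)
    moreover have "length v < length u" using r(1) u by (simp add: P_def)
    ultimately obtain rs where "concat rs = v" "\<forall>r\<in>set rs. minimal_invertible A w r"
      using 1(1) rv by (auto simp: invertible_def)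
    then show ?thesis using u min by (intro exI[of _ "r # rs"]) auto
  qed
qed

lemma relator_decomposition:
  assumes "w \<in> lists A"
  shows "\<exists>!rs. concat rs = w \<and> (\<forall>r\<in>set rs. minimal_invertible A w r)"
proof -
  interpret M: monoid "one_relator_monoid A w"
    by (rule monoid_one_relator_monoid[OF assms])
  have "represented A w w = \<one>\<^bsub>one_relator_monoid A w\<^esub>"
    using assms by (simp add: one_one_relator_monoid represented_eq_iff relator_cong.relator)
  then have "invertible A w w" by (simp add: invertible_def)
  then show ?thesis
    using decomposition_exists[OF assms assms] decomposition_unique by (metis (mono_tags))
qed

definition C1 :: "word set \<Rightarrow> bool" where
  "C1 \<Delta> \<longleftrightarrow> (\<forall>u\<in>\<Delta>. \<forall>v\<in>\<Delta>. \<not> strict_sublist u v)"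

definition C2 :: "word set \<Rightarrow> nat \<Rightarrow> bool" where
  "C2 \<Delta> a \<longleftrightarrow> (\<exists>\<gamma>\<in>\<Delta>. \<exists>\<delta>\<in>\<Delta>. \<gamma> \<noteq> \<delta> \<and> prefix [a] \<gamma> \<and> prefix [a] \<delta>)"

definition C3 :: "word set \<Rightarrow> nat \<Rightarrow> bool" where
  "C3 \<Delta> a \<longleftrightarrow> (\<forall>u\<in>\<Delta>. \<not> prefix [a, a] u)"

text \<open>The letter \<open>a\<close> in the third condition is the one provided by the second.\<close>

definition overlap_conditions :: "word set \<Rightarrow> bool" where
  "overlap_conditions \<Delta> \<longleftrightarrow> C1 \<Delta> \<and> (\<exists>a. C2 \<Delta> a \<and> C3 \<Delta> a)"

definition word_power :: "word \<Rightarrow> nat \<Rightarrow> word" where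
  "word_power u n = concat (replicate n u)"

end

theory Submission imports Defs begin

text \<open>
  The three parts all come down to one claim: a decision procedure for the equations of one monoid
  \<open>M = \<langle>A | w = 1\<rangle>\<close> satisfying the overlap conditions yields one for word equations with length
  constraints. The reason is that \<open>M\<close> contains a free monoid together with its length function, and
  both can be described by equations.

  Let \<open>a\<close> be the letter common to two pieces, and let \<open>G\<close> be the set of all pieces
  \<open>r = a r'\<close> starting with \<open>a\<close>. Since \<open>r\<close> is invertible, \<open>r' r\<^sup>-\<^sup>1\<close> is a right inverse of \<open>a\<close>.
  A product of \<open>n\<close> such right inverses is killed by multiplication with \<open>a^n\<close> from the left, and
  three facts turn this into a definition of a free monoid with length by equations:
  the solutions of \<open>z a = a z\<close> are the powers of \<open>a\<close> (\<open>centralizer\<close>);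
  the solutions of \<open>a^n x = 1\<close> are the products of \<open>n\<close> right inverses
  (\<open>annihilated_by_power\<close>, \<open>power_annihilates\<close>); and the right inverses generate a free monoid
  (\<open>\<Phi>_inj\<close>). So \<open>x\<close> lies in the free monoid iff \<open>z a = a z\<close> and \<open>z x = 1\<close> for some \<open>z\<close>, and \<open>x\<close> is
  at most as long as \<open>y\<close> iff \<open>z x = 1\<close> and \<open>z z' y = 1\<close> for some \<open>z\<close> and \<open>z'\<close> commuting with \<open>a\<close>.

  The three facts are read off from normal forms. Under condition C1 no two pieces
  overlap: the common part would be left and right invertible, hence a shorter invertible prefix.
  Therefore replacing pieces by the units they represent, in words whose letters are
  letters of \<open>A\<close> or units of \<open>M\<close>, is a rewriting process without critical pairs except those of the
  multiplication table of the units. Instead of proving confluence, letters are made to act on the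
  irreducible words; the relator acts trivially, so that the image of the empty word
  under the action of \<open>u\<close> depends on \<open>u\<close> as an element of \<open>M\<close> only, and it determines that element.

  The free monoid obtained has rank at least two, but an alphabet \<open>S\<close> may be larger. Letters of
  \<open>S\<close> are therefore coded by distinct blocks of a common length \<open>k\<close> (\<open>exists_block_code\<close>), which multiplies
  all lengths by \<open>k\<close>; the condition \<open>z^k x = 1\<close> restricts a variable to products of blocks. Blocks
  that code no letter do no harm, since a solution is turned into one over \<open>S\<close> by replacing them by
  an arbitrary letter (\<open>translate_system_solvable_iff\<close>). The translation of systems is
  computable (\<open>recursive_translate_system\<close>).

  For the statement on monoids with torsion one example is enough: in
  \<open>\<langle>a, b, c | (ab ac ab)\<^sup>2 = 1\<rangle>\<close> the minimal invertible pieces are \<open>ab\<close> and \<open>ac\<close>.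
\<close>

section \<open>Closure properties of the recursive functions\<close>

lemmas recursive_fst = recursive.comp[OF recursive.left]
lemmas recursive_snd = recursive.comp[OF recursive.right]
lemmas recursive_Suc = recursive.comp[OF recursive.succ]

lemma recursive_id: "recursive (\<lambda>n. n)"
  using recursive.pair[OF recursive.left recursive.right] by simp

lemma recursive_const: "recursive (\<lambda>_. c)"
  by (induction c) (auto intro: recursive.zero recursive_Suc)

lemma recursive_rec_nat:
  assumes "recursive f" "recursive g" "recursive c"
  shows "recursive (\<lambda>n. rec_nat (f n) (\<lambda>m r. g (prod_encode (n, prod_encode (m, r)))) (c n))"
  using recursive.comp[OF recursive.prim_rec[OF assms(1,2)]
      recursive.pair[OF recursive_id assms(3)]]
  by simp

lemma recursive_if_zero:
  assumes "recursive c" "recursive f" "recursive g"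
  shows "recursive (\<lambda>n. if c n = 0 then f n else g n)"
proof -
  have "rec_nat (f n) (\<lambda>m r. g n) (c n) = (if c n = 0 then f n else g n)" for n
    by (cases "c n") simp_all
  then show ?thesis
    using recursive_rec_nat[OF assms(2) recursive.comp[OF assms(3) recursive.left] assms(1)]
    by simp
qed

lemma recursive_pred:
  assumes "recursive f"
  shows "recursive (\<lambda>n. f n - 1)"
proof -
  have "rec_nat 0 (\<lambda>m r. m) k = k - 1" for k :: nat
    by (cases k) simp_all
  then show ?thesis
    using recursive_rec_nat[OF recursive.zero recursive_fst[OF recursive.right] assms] by simp
qed

lemma recursive_funpow:
  assumes "recursive s" "recursive f" "recursive c"
  shows "recursive (\<lambda>n. (s ^^ c n) (f n))"
proof -
  have "rec_nat x (\<lambda>m r. s r) k = (s ^^ k) x" for x k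
    by (induction k) simp_all
  then show ?thesis
    using recursive_rec_nat[OF assms(2) recursive.comp[OF assms(1) recursive_snd[OF recursive.right]]
      assms(3)] by simp
qed

lemma recursive_double:
  assumes "recursive f"
  shows "recursive (\<lambda>n. 2 * f n)"
proof -
  have "((\<lambda>m. Suc (Suc m)) ^^ k) 0 = 2 * k" for k
    by (induction k) simp_all
  then show ?thesis
    using recursive_funpow[OF recursive_Suc[OF recursive.succ] recursive.zero assms] by simp
qed

lemma recursive_parity: "recursive (\<lambda>n. n mod 2)"
proof -
  have "((\<lambda>m::nat. if m = 0 then 1 else 0) ^^ k) 0 = k mod 2" for k :: nat
    by (induction k) (auto simp: mod_Suc)
  then show ?thesis
    using recursive_funpow[OF recursive_if_zero[OF recursive_id recursive_const[of 1] recursive.zero]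
      recursive.zero recursive_id] by simp
qed

text \<open>Any finite part of a function is recursive; this makes the coding of the letters of a finite
  alphabet computable without any information on the coding words.\<close>

lemma recursive_table: "\<exists>f. recursive f \<and> (\<forall>n<N. f n = h n)"
proof (induction N arbitrary: h)
  case 0
  show ?case using recursive.zero by auto
next
  case (Suc N)
  obtain f where f: "recursive f" "\<forall>n<N. f n = h (Suc n)"
    using Suc.IH[of "\<lambda>n. h (Suc n)"] by blast
  let ?g = "\<lambda>n. if n = 0 then h 0 else f (n - 1)"
  have "recursive ?g"
    by (rule recursive_if_zero[OF recursive_id recursive_const
          recursive.comp[OF f(1) recursive_pred[OF recursive_id]]])
  moreover have "?g n = h n" if "n < Suc N" for n
    using f(2) that by (cases n) simp_all
  ultimately show ?case by blast
qed

lemma length_list_decode: "length (list_decode n) \<le> n"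
proof (induction n rule: list_decode.induct)
  case (2 n)
  obtain x y where xy: "prod_decode n = (x, y)" by fastforce
  then have "y \<le> n" by (metis le_prod_encode_2 prod_decode_inverse)
  then show ?case using 2[OF xy[symmetric]] xy by simp
qed simp

text \<open>The loop state pairs the code of the remaining list with the accumulator. The code of a list
  bounds its length, so it can serve as the number of iterations; surplus iterations leave the state
  unchanged.\<close>

lemma recursive_fold:
  assumes s: "recursive s" and f: "recursive f" and g: "recursive g"
  shows "recursive (\<lambda>n. fold (\<lambda>x r. s (prod_encode (x, r))) (list_decode (f n)) (g n))"
proof -
  let ?fold = "fold (\<lambda>x r. s (prod_encode (x, r)))"
  define step where "step = (\<lambda>p. if fst (prod_decode p) = 0 then p
    else prod_encode (snd (prod_decode (fst (prod_decode p) - 1)),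
      s (prod_encode (fst (prod_decode (fst (prod_decode p) - 1)), snd (prod_decode p)))))"
  have "recursive step"
    unfolding step_def
    by (intro recursive_if_zero recursive_id recursive.left recursive.right recursive.pair
        recursive_fst recursive_snd recursive_pred recursive.comp[OF s])
  moreover have "(step ^^ m) (prod_encode (list_encode xs, r)) = prod_encode (0, ?fold xs r)"
    if "length xs \<le> m" for m xs r
    using that
  proof (induction m arbitrary: xs r)
    case (Suc m)
    show ?case
    proof (cases xs)
      case Nil
      then have "step (prod_encode (list_encode xs, r)) = prod_encode (list_encode xs, r)"
        by (simp add: step_def)
      then show ?thesis using Suc.IH[of xs r] Nil by (simp add: funpow_swap1)
    next
      case (Cons x ys)
      then have "step (prod_encode (list_encode xs, r)) =
          prod_encode (list_encode ys, s (prod_encode (x, r)))"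
        by (simp add: step_def)
      then show ?thesis using Suc.IH[of ys] Suc.prems Cons by (simp add: funpow_swap1)
    qed
  qed simp
  from this[OF length_list_decode]
  have "(step ^^ k) (prod_encode (k, r)) = prod_encode (0, ?fold (list_decode k) r)" for k r
    by simp
  ultimately show ?thesis
    using recursive_snd[OF recursive_funpow[OF _ recursive.pair[OF f g] f], of step] by simp
qed

lemma fold_Suc_prod_encode:
  "fold (\<lambda>x r. Suc (prod_encode (x, r))) xs r = list_encode (rev xs @ list_decode r)"
  by (induction xs arbitrary: r) simp_all

text \<open>Since \<open>Suc (prod_encode (x, r))\<close> is the code of a list with head \<open>x\<close>, reversal is a fold with step
  function \<^const>\<open>Suc\<close>, and so is appending to a reversed list.\<close>

lemma recursive_rev:
  assumes "recursive f"
  shows "recursive (\<lambda>n. list_encode (rev (list_decode (f n))))"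
  using recursive_fold[OF recursive.succ assms recursive.zero]
  by (simp add: fold_Suc_prod_encode)

lemma recursive_append:
  assumes "recursive f" "recursive g"
  shows "recursive (\<lambda>n. list_encode (list_decode (f n) @ list_decode (g n)))"
  using recursive_fold[OF recursive.succ recursive_rev[OF assms(1)] assms(2)]
  by (simp add: fold_Suc_prod_encode)

lemma recursive_concat_map:
  assumes g: "recursive g" and f: "recursive f"
  shows "recursive (\<lambda>n. list_encode (concat (map (\<lambda>x. list_decode (g x)) (list_decode (f n)))))"
proof -
  have "fold (\<lambda>x r. list_encode (list_decode (g x) @ list_decode r)) (rev xs) 0
      = list_encode (concat (map (\<lambda>x. list_decode (g x)) xs))" for xs
    by (induction xs) simp_all
  then show ?thesis
    using recursive_fold[OF recursive_append[OF recursive.comp[OF g recursive.left] recursive.right]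
        recursive_rev[OF f] recursive.zero]
    by simp
qed

text \<open>Words whose letters are letters of the alphabet (\<^const>\<open>Inl\<close>) or elements of the monoid
  (\<^const>\<open>Inr\<close>), the latter always units.\<close>

type_synonym mixed = "(nat + word set) list"

section \<open>Normal forms\<close>

text \<open>A factor shared by the end of one unit and the beginning of another has a left and a right
  inverse, which then agree.\<close>

lemma (in monoid) Units_middle:
  assumes "x \<in> carrier G" "y \<in> carrier G" "z \<in> carrier G"
    "x \<otimes> y \<in> Units G" "y \<otimes> z \<in> Units G"
  shows "y \<in> Units G"
proof -
  let ?l = "inv (x \<otimes> y) \<otimes> x" and ?r = "z \<otimes> inv (y \<otimes> z)"
  have l: "?l \<in> carrier G" "?l \<otimes> y = \<one>"
    using assms by (simp_all add: m_assoc)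
  have r: "?r \<in> carrier G" "y \<otimes> ?r = \<one>"
    using assms by (simp_all add: m_assoc[symmetric])
  have "?l = ?r" by (rule inv_unique[OF l(2) r(2) assms(2) l(1) r(1)])
  then show ?thesis
    using l r assms(2) unfolding Units_def by auto
qed

locale nonoverlapping_pieces =
  fixes A :: "nat set" and w :: word
  assumes w_in: "w \<in> lists A" and C1: "C1 (minimal_pieces A w)"
begin

abbreviation "M \<equiv> one_relator_monoid A w"
abbreviation "\<Delta> \<equiv> minimal_pieces A w"
abbreviation cls :: "word \<Rightarrow> word set" where "cls \<equiv> represented A w"
abbreviation cong :: "word \<Rightarrow> word \<Rightarrow> bool" (infix "\<approx>" 50) where
  "u \<approx> v \<equiv> (u, v) \<in> relator_cong A w"

sublocale monoid M by (rule monoid_one_relator_monoid[OF w_in])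

lemma cls_closed: "u \<in> lists A \<Longrightarrow> cls u \<in> carrier M"
  by (rule represented_in_carrier)

lemma cls_append: "u \<in> lists A \<Longrightarrow> v \<in> lists A \<Longrightarrow> cls (u @ v) = cls u \<otimes>\<^bsub>M\<^esub> cls v"
  using mult_represented[OF w_in] by simp

lemma cls_Nil: "cls [] = \<one>\<^bsub>M\<^esub>"
  by (simp add: one_one_relator_monoid)

lemma cls_eq_iff: "u \<in> lists A \<Longrightarrow> v \<in> lists A \<Longrightarrow> cls u = cls v \<longleftrightarrow> u \<approx> v"
  by (rule represented_eq_iff[OF w_in])

lemma relator_pieces:
  obtains rs where "concat rs = w" "set rs = \<Delta>" "\<And>r. r \<in> \<Delta> \<Longrightarrow> minimal_invertible A w r"
proof -
  let ?P = "\<lambda>rs. concat rs = w \<and> (\<forall>r\<in>set rs. minimal_invertible A w r)"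
  define rs where "rs = (THE rs. ?P rs)"
  have "?P rs"
    unfolding rs_def by (rule theI'[OF relator_decomposition[OF w_in]])
  moreover have "set rs = \<Delta>" by (simp only: rs_def minimal_pieces_def)
  ultimately show ?thesis using that[of rs] by blast
qed

lemma piece_minimal: "r \<in> \<Delta> \<Longrightarrow> minimal_invertible A w r"
  using relator_pieces by metis

lemma piece_in: "r \<in> \<Delta> \<Longrightarrow> r \<in> lists A"
proof -
  assume r: "r \<in> \<Delta>"
  obtain rs where rs: "concat rs = w" "set rs = \<Delta>" using relator_pieces by metis
  then have "set r \<subseteq> set w" using r by auto
  then show "r \<in> lists A" using w_in by auto
qed

lemma piece_not_Nil: "r \<in> \<Delta> \<Longrightarrow> r \<noteq> []"
  using piece_minimal by (simp add: minimal_invertible_def)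

lemma piece_unit: "r \<in> \<Delta> \<Longrightarrow> cls r \<in> Units M"
  using piece_minimal by (simp add: minimal_invertible_def invertible_def)

lemma prefix_pieces_eq:
  assumes "r \<in> \<Delta>" "s \<in> \<Delta>" "prefix r x" "prefix s x"
  shows "r = s"
  using minimal_invertible_prefix_unique[OF piece_minimal piece_minimal, OF assms(1,2)] assms(3,4)
  by (auto simp: prefix_def)

text \<open>Here the first condition and minimality work together: if \<open>s\<close> were a prefix of \<open>q\<close>, it would be a
  proper subword of the piece \<open>p @ q\<close>; if \<open>q\<close> were a proper prefix of \<open>s\<close>, it would be a unit by
  \<open>Units_middle\<close>, contradicting the minimality of \<open>s\<close>.\<close>

lemma pieces_no_overlap:
  assumes pq: "p @ q \<in> \<Delta>" "p \<noteq> []" "q \<noteq> []" and s: "s \<in> \<Delta>"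
  shows "\<not> prefix s q" "\<not> prefix q s"
proof -
  show *: "\<not> prefix s q"
  proof
    assume "prefix s q"
    then obtain t where t: "q = s @ t" by (auto simp: prefix_def)
    then have "sublist s (p @ q)" by auto
    moreover have "length s < length (p @ q)" using t pq(2) by simp
    then have "s \<noteq> p @ q" by blast
    ultimately show False using C1 pq(1) s by (auto simp: C1_def strict_sublist_def)
  qed
  show "\<not> prefix q s"
  proof
    assume pre: "prefix q s"
    then obtain t where t: "s = q @ t" by (auto simp: prefix_def)
    have "p @ q \<in> lists A" "s \<in> lists A" using pq(1) s by (simp_all only: piece_in)
    then have l: "p \<in> lists A" "q \<in> lists A" "t \<in> lists A" using t by auto
    have "cls q \<in> Units M"
      using Units_middle[of "cls p" "cls q" "cls t"] l piece_unit[OF pq(1)] piece_unit[OF s] t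
      by (simp add: cls_closed cls_append)
    moreover have "strict_prefix q s" using pre * by (auto simp: strict_prefix_def)
    ultimately show False
      using piece_minimal[OF s] pq(3) by (simp add: minimal_invertible_def invertible_def)
  qed
qed

text \<open>Words to which no rule applies, the rules being: a piece is replaced by the unit it represents,
  adjacent units are multiplied, and the unit one is deleted.\<close>

fun normal :: "mixed \<Rightarrow> bool" where
  "normal [] \<longleftrightarrow> True"
| "normal (Inl c # X) \<longleftrightarrow>
     c \<in> A \<and> normal X \<and> (\<forall>r\<in>\<Delta>. \<not> prefix (map Inl r) (Inl c # X))"
| "normal (Inr u # X) \<longleftrightarrow>
     u \<in> Units M \<and> u \<noteq> \<one>\<^bsub>M\<^esub> \<and> normal X \<and> (\<forall>v Y. X \<noteq> Inr v # Y)"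

fun unit_act :: "word set \<Rightarrow> mixed \<Rightarrow> mixed" where
  "unit_act u (Inr v # X) = (if u \<otimes>\<^bsub>M\<^esub> v = \<one>\<^bsub>M\<^esub> then X else Inr (u \<otimes>\<^bsub>M\<^esub> v) # X)"
| "unit_act u X = (if u = \<one>\<^bsub>M\<^esub> then X else Inr u # X)"

text \<open>In an irreducible word with a letter put in front, a piece can only occur at the very front, and it is
  unique because no piece is a prefix of another.\<close>

definition letter_act :: "nat \<Rightarrow> mixed \<Rightarrow> mixed" where
  "letter_act c X =
     (if \<exists>r\<in>\<Delta>. prefix (map Inl r) (Inl c # X)
      then let r = (THE r. r \<in> \<Delta> \<and> prefix (map Inl r) (Inl c # X))
           in unit_act (cls r) (drop (length r) (Inl c # X))
      else Inl c # X)"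

abbreviation act :: "word \<Rightarrow> mixed \<Rightarrow> mixed" where
  "act x X \<equiv> foldr letter_act x X"

lemma prefix_map_Inl: "prefix (map Inl x :: mixed) (map Inl y) \<longleftrightarrow> prefix x y"
proof (induction x arbitrary: y)
  case (Cons c x)
  then show ?case by (cases y) simp_all
qed simp

lemma prefix_map_pieces_eq:
  assumes "r \<in> \<Delta>" "s \<in> \<Delta>" "prefix (map Inl r) X" "prefix (map Inl s) (X :: mixed)"
  shows "r = s"
proof -
  have "prefix (map Inl r :: mixed) (map Inl s) \<or> prefix (map Inl s :: mixed) (map Inl r)"
    using assms(3,4) prefix_same_cases by blast
  then have "prefix r s \<or> prefix s r" by (simp only: prefix_map_Inl)
  then show ?thesis
    using prefix_pieces_eq[OF assms(1,2)] by (metis prefix_order.refl)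
qed

lemma letter_act_reduce:
  assumes "r \<in> \<Delta>" "Inl c # X = map Inl r @ Y"
  shows "letter_act c X = unit_act (cls r) Y"
proof -
  have r: "r \<in> \<Delta> \<and> prefix (map Inl r) (Inl c # X)" using assms by simp
  then have "(THE r. r \<in> \<Delta> \<and> prefix (map Inl r) (Inl c # X)) = r"
    by (rule the_equality) (use r prefix_map_pieces_eq in blast)
  then show ?thesis using r assms(2) by (auto simp: letter_act_def Let_def)
qed

lemma letter_act_cases:
  obtains (reduce) r Y where "r \<in> \<Delta>" "Inl c # X = map Inl r @ Y"
      "letter_act c X = unit_act (cls r) Y"
  | (irreducible) "\<forall>r\<in>\<Delta>. \<not> prefix (map Inl r) (Inl c # X)" "letter_act c X = Inl c # X"
proof (cases "\<exists>r\<in>\<Delta>. prefix (map Inl r) (Inl c # X)")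
  case True
  then obtain r Y where "r \<in> \<Delta>" "Inl c # X = map Inl r @ Y" by (auto simp: prefix_def)
  then show ?thesis using letter_act_reduce reduce by blast
next
  case False
  then show ?thesis using irreducible by (simp add: letter_act_def)
qed

lemma normal_append: "normal (X @ Y) \<Longrightarrow> normal Y"
proof (induction X)
  case (Cons x X)
  then show ?case by (cases x) simp_all
qed simp

lemma normal_unit_act:
  assumes "normal X" "u \<in> Units M"
  shows "normal (unit_act u X)"
proof (cases "(u, X)" rule: unit_act.cases)
  case (1 u v X)
  then show ?thesis using assms by auto
qed (use assms in auto)

lemma normal_letter_act:
  assumes "normal X" "c \<in> A"
  shows "normal (letter_act c X)"
proof (cases c X rule: letter_act_cases)
  case (reduce r Y)
  obtain x r' where r: "r = x # r'" using piece_not_Nil[OF reduce(1)] by (cases r) simp_all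
  then have "normal Y" using assms(1) normal_append reduce(2) by auto
  then show ?thesis using reduce normal_unit_act piece_unit by simp
qed (use assms in simp)

lemma normal_act: "x \<in> lists A \<Longrightarrow> normal X \<Longrightarrow> normal (act x X)"
  by (induction x) (auto intro: normal_letter_act)

lemma unit_act_one: "normal X \<Longrightarrow> unit_act \<one>\<^bsub>M\<^esub> X = X"
  by (cases "(\<one>\<^bsub>M\<^esub>, X)" rule: unit_act.cases) auto

lemma unit_act_mult:
  assumes "normal X" "u \<in> Units M" "v \<in> Units M"
  shows "unit_act u (unit_act v X) = unit_act (u \<otimes>\<^bsub>M\<^esub> v) X"
proof (cases "(v, X)" rule: unit_act.cases)
  case (1 v' x Y)
  have x: "x \<in> Units M" "x \<noteq> \<one>\<^bsub>M\<^esub>" "normal Y" "\<forall>v Z. Y \<noteq> Inr v # Z"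
    using assms(1) 1 by auto
  have e: "unit_act u' Y = (if u' = \<one>\<^bsub>M\<^esub> then Y else Inr u' # Y)" for u'
    using x(4) by (cases "(u', Y)" rule: unit_act.cases) auto
  have "u \<otimes>\<^bsub>M\<^esub> v \<otimes>\<^bsub>M\<^esub> x = u \<otimes>\<^bsub>M\<^esub> (v \<otimes>\<^bsub>M\<^esub> x)"
    using x assms by (simp add: m_assoc Units_closed)
  then show ?thesis using 1 x assms by (auto simp: e)
next
  case ("2_1" v')
  then show ?thesis using assms by auto
next
  case ("2_2" v' c Y)
  then show ?thesis using assms by auto
qed

text \<open>A proper suffix of a piece acts without any reduction, whatever follows: a piece arising on the
  way would overlap with the given one. This lets the action of a whole
  piece, and later of the right inverses, be computed at once.\<close>

lemma act_suffix:
  assumes "p @ q \<in> \<Delta>" "p \<noteq> []"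
  shows "act q X = map Inl q @ X"
  using assms
proof (induction q arbitrary: p)
  case (Cons c q)
  have IH: "act q X = map Inl q @ X" using Cons.IH[of "p @ [c]"] Cons.prems by simp
  show ?case
  proof (cases c "act q X" rule: letter_act_cases)
    case (reduce r Y)
    then have "prefix (map Inl r) (map Inl (c # q) @ X)" by (simp add: IH)
    then have "prefix (map Inl r :: mixed) (map Inl (c # q)) \<or> prefix (map Inl (c # q) :: mixed) (map Inl r)"
      by (metis prefixI prefix_same_cases)
    then have "prefix r (c # q) \<or> prefix (c # q) r" by (simp only: prefix_map_Inl)
    then show ?thesis using pieces_no_overlap[OF Cons.prems _ reduce(1)] by simp
  next
    case irreducible
    then show ?thesis by (simp add: IH)
  qed
qed simp

lemma act_piece:
  assumes "r \<in> \<Delta>"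
  shows "act r X = unit_act (cls r) X"
proof (cases r)
  case (Cons c q)
  then have "act q X = map Inl q @ X" using act_suffix[of "[c]" q] assms by simp
  then show ?thesis using letter_act_reduce[OF assms, of c "act q X" X] Cons by simp
qed (use piece_not_Nil assms in simp)

lemma act_pieces:
  assumes "set rs \<subseteq> \<Delta>" "normal X"
  shows "act (concat rs) X = unit_act (cls (concat rs)) X \<and> cls (concat rs) \<in> Units M"
  using assms(1)
proof (induction rs)
  case Nil
  then show ?case using unit_act_one[OF assms(2)] by (simp add: cls_Nil)
next
  case (Cons r rs)
  have "concat rs \<in> lists A" using Cons.prems piece_in by fastforce
  moreover have "r \<in> lists A" using Cons.prems piece_in by simp
  ultimately have "cls (concat (r # rs)) = cls r \<otimes>\<^bsub>M\<^esub> cls (concat rs)"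
    by (simp add: cls_append)
  then show ?case
    using Cons act_piece[of r] unit_act_mult[OF assms(2)] piece_unit[of r] by simp
qed

text \<open>The relator is a product of pieces, so it acts as the unit it represents, which is one.\<close>

lemma act_relator: "normal X \<Longrightarrow> act w X = X"
proof -
  assume X: "normal X"
  obtain rs where rs: "concat rs = w" "set rs = \<Delta>" using relator_pieces by metis
  have "w \<approx> []" by (rule relator_cong.relator)
  then have "cls w = \<one>\<^bsub>M\<^esub>" using cls_eq_iff[OF w_in, of "[]"] by (simp add: cls_Nil)
  then show ?thesis using act_pieces[of rs X] rs X unit_act_one by simp
qed

lemma act_cong:
  assumes "u \<approx> v" "normal X"
  shows "act u X = act v X"
  using assms
proof (induction arbitrary: X)
  case (append u v u' v')
  have "u' \<in> lists A" using append.hyps relator_cong_subset[OF w_in] by blast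
  then show ?case using append.IH append.prems normal_act by (metis foldr_append comp_apply)
qed (simp_all add: act_relator)

text \<open>Evaluation recovers an element of the monoid from its normal form, which makes the normal form
  a complete invariant.\<close>

fun eval_mixed :: "mixed \<Rightarrow> word set" where
  "eval_mixed [] = \<one>\<^bsub>M\<^esub>"
| "eval_mixed (Inl c # X) = cls [c] \<otimes>\<^bsub>M\<^esub> eval_mixed X"
| "eval_mixed (Inr u # X) = u \<otimes>\<^bsub>M\<^esub> eval_mixed X"

lemma eval_mixed_closed: "normal X \<Longrightarrow> eval_mixed X \<in> carrier M"
  by (induction X rule: eval_mixed.induct) (auto simp: cls_closed)

lemma eval_unit_act:
  assumes "normal X" "u \<in> Units M"
  shows "eval_mixed (unit_act u X) = u \<otimes>\<^bsub>M\<^esub> eval_mixed X"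
proof (cases "(u, X)" rule: unit_act.cases)
  case (1 u' v Y)
  then have v: "v \<in> carrier M" "u \<in> carrier M" "eval_mixed Y \<in> carrier M"
    using assms by (auto simp: eval_mixed_closed)
  show ?thesis
    using 1 m_assoc[OF v(2,1,3)] v by (auto dest: HOL.sym)
qed (use eval_mixed_closed[OF assms(1)] in auto)

lemma eval_map_Inl:
  assumes "x \<in> lists A" "normal X"
  shows "eval_mixed (map Inl x @ X) = cls x \<otimes>\<^bsub>M\<^esub> eval_mixed X"
  using assms(1)
proof (induction x)
  case Nil
  then show ?case by (simp add: cls_Nil eval_mixed_closed assms(2))
next
  case (Cons c x)
  then show ?case
    using cls_append[of "[c]" x] eval_mixed_closed[OF assms(2)] by (simp add: cls_closed m_assoc)
qed

lemma eval_letter_act: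
  assumes "normal X" "c \<in> A"
  shows "eval_mixed (letter_act c X) = cls [c] \<otimes>\<^bsub>M\<^esub> eval_mixed X"
proof (cases c X rule: letter_act_cases)
  case (reduce r Y)
  obtain x r' where r: "r = x # r'" using piece_not_Nil[OF reduce(1)] by (cases r) simp_all
  then have "normal Y" using assms(1) normal_append reduce(2) by auto
  then have "eval_mixed (letter_act c X) = eval_mixed (Inl c # X)"
    unfolding reduce(2,3) using eval_unit_act piece_unit eval_map_Inl piece_in reduce(1) by simp
  then show ?thesis by simp
qed simp

lemma eval_act:
  assumes "normal X" "x \<in> lists A"
  shows "eval_mixed (act x X) = cls x \<otimes>\<^bsub>M\<^esub> eval_mixed X"
  using assms(2)
proof (induction x)
  case Nil
  then show ?case by (simp add: cls_Nil eval_mixed_closed assms(1))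
next
  case (Cons c x)
  then show ?case
    using cls_append[of "[c]" x] eval_mixed_closed[OF assms(1)] normal_act[OF _ assms(1)]
    by (simp add: cls_closed m_assoc eval_letter_act)
qed

abbreviation nf :: "word \<Rightarrow> mixed" where "nf x \<equiv> act x []"

lemma eval_nf: "x \<in> lists A \<Longrightarrow> eval_mixed (nf x) = cls x"
  using eval_act[of "[]" x] by (simp add: cls_closed)

lemma normal_nf: "x \<in> lists A \<Longrightarrow> normal (nf x)"
  by (simp add: normal_act)

end

section \<open>Right inverses of a letter\<close>

locale overlapping_pieces = nonoverlapping_pieces +
  fixes a :: nat
  assumes C2: "C2 (minimal_pieces A w) a" and C3: "C3 (minimal_pieces A w) a"
begin

definition G :: "word set" where "G = {r \<in> \<Delta>. prefix [a] r}"

lemma two_pieces: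
  obtains r s where "r \<in> G" "s \<in> G" "r \<noteq> s"
  using C2 by (auto simp: C2_def G_def)

lemma a_not_piece: "[a] \<notin> \<Delta>"
proof
  assume a: "[a] \<in> \<Delta>"
  obtain r s where "r \<in> G" "s \<in> G" "r \<noteq> s" by (rule two_pieces)
  then show False
    using prefix_pieces_eq[OF a, of r r] prefix_pieces_eq[OF a, of s s] by (auto simp: G_def)
qed

lemma GE:
  assumes "r \<in> G"
  obtains b q where "r = a # b # q" "b \<noteq> a" "r \<in> \<Delta>"
proof -
  obtain p where p: "r = a # p" "r \<in> \<Delta>" using assms by (auto simp: G_def prefix_def)
  moreover from p obtain b q where "p = b # q" using a_not_piece by (cases p) auto
  moreover from calculation have "b \<noteq> a" using C3 by (auto simp: C3_def prefix_def)
  ultimately show ?thesis using that by blast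
qed

lemma a_in: "a \<in> A"
proof -
  obtain r s where "r \<in> G" "s \<in> G" "r \<noteq> s" by (rule two_pieces)
  then obtain b q where "a # b # q \<in> \<Delta>" by (metis GE)
  then show ?thesis using piece_in by force
qed

text \<open>A piece ending in \<open>a\<close> would overlap in \<open>a\<close> with every piece that starts with \<open>a\<close>.\<close>

lemma piece_last: "r \<in> \<Delta> \<Longrightarrow> r \<noteq> p @ [a]"
proof
  assume r: "r \<in> \<Delta>" "r = p @ [a]"
  then have "p \<noteq> []" using a_not_piece by auto
  moreover obtain s t where "s \<in> G" "t \<in> G" "s \<noteq> t" by (rule two_pieces)
  ultimately show False
    using pieces_no_overlap(2)[of p "[a]" s] r by (auto simp: G_def)
qed

text \<open>Consequently a final \<open>a\<close> never takes part in a reduction, so multiplication with \<open>a\<close> from the right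
  appends it to the normal form.\<close>

lemma letter_act_snoc: "letter_act c (X @ [Inl a]) = letter_act c X @ [Inl a]"
proof (cases c X rule: letter_act_cases)
  case (reduce r Y)
  have "unit_act u (Y @ [Inl a]) = unit_act u Y @ [Inl a]" for u
    by (cases "(u, Y)" rule: unit_act.cases) auto
  then show ?thesis
    using reduce(3) letter_act_reduce[OF reduce(1), of c "X @ [Inl a]" "Y @ [Inl a]"] reduce(2)
    by (simp flip: append_Cons)
next
  case irr: irreducible
  show ?thesis
  proof (cases c "X @ [Inl a]" rule: letter_act_cases)
    case (reduce r Y)
    show ?thesis
    proof (cases Y rule: rev_cases)
      case Nil
      then have "map Inl r = (Inl c # X) @ [Inl a]" using reduce(2) by simp
      then have "r = butlast r @ [a]"
        by (metis append_butlast_last_id append_is_Nil_conv last_map last_snoc list.map_disc_iff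
            not_Cons_self2 sum.inject(1))
      then show ?thesis using piece_last[OF reduce(1)] by blast
    next
      case (snoc Z z)
      then have "Inl c # X = map Inl r @ Z" using reduce(2) by (metis append_Cons append_assoc butlast_snoc)
      then show ?thesis using irr(1) reduce(1) by (metis prefixI)
    qed
  qed (use irr in simp)
qed

lemma nf_a: "nf [a] = [Inl a]"
proof (cases a "[] :: mixed" rule: letter_act_cases)
  case (reduce r Y)
  then have "r = [a]" using piece_not_Nil[OF reduce(1)] by (cases r) auto
  then show ?thesis using a_not_piece reduce(1) by simp
qed simp

lemma nf_snoc_a: "nf (x @ [a]) = nf x @ [Inl a]"
proof -
  have "act x (X @ [Inl a]) = act x X @ [Inl a]" for X
    by (induction x) (simp_all add: letter_act_snoc)
  from this[of "[]"] show ?thesis using nf_a by simp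
qed

lemma length_unit_act: "length (unit_act u X) \<le> Suc (length X)"
  by (cases "(u, X)" rule: unit_act.cases) auto

lemma Cons_eq_snoc_replicate: "x # X = X @ [x] \<Longrightarrow> X = replicate (length X) x"
  by (induction X) auto

text \<open>The normal form of \<open>z a\<close> is longer by one than the one of \<open>z\<close>. If \<open>a\<close> reduced against the normal
  form of \<open>z\<close>, then a piece of length at least two would be replaced by at most one unit and
  the normal form of \<open>a z\<close> would be too short. So \<open>a\<close> is also just put in front, and a word \<open>X\<close> with
  \<open>a X = X a\<close> is a power of \<open>a\<close>.\<close>

lemma centralizer:
  assumes "z \<in> lists A" "z @ [a] \<approx> [a] @ z"
  shows "\<exists>n. z \<approx> replicate n a"
proof -
  have eq: "nf z @ [Inl a] = letter_act a (nf z)"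
    using act_cong[OF assms(2), of "[]"] nf_snoc_a by simp
  show ?thesis
  proof (cases a "nf z" rule: letter_act_cases)
    case (reduce r Y)
    then have "r \<in> G" using piece_not_Nil[OF reduce(1)] by (cases r) (auto simp: G_def)
    then obtain b q where "r = a # b # q" by (rule GE)
    then have "length (nf z) = Suc (length q) + length Y" using reduce(2) by simp
    then show ?thesis
      using arg_cong[OF eq, of length] reduce(3) length_unit_act[of "cls r" Y] by simp
  next
    case irreducible
    then have "Inl a # nf z = nf z @ [Inl a]" using eq by simp
    then have *: "nf z = map Inl (replicate (length (nf z)) a)"
      using Cons_eq_snoc_replicate by (metis map_replicate)
    let ?p = "replicate (length (nf z)) a"
    have p: "?p \<in> lists A" using a_in by auto
    have "cls z = eval_mixed (map Inl ?p @ [])" using eval_nf[OF assms(1)] * by simp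
    also have "\<dots> = cls ?p" using eval_map_Inl[OF p, of "[]"] p by (simp add: cls_closed)
    finally show ?thesis using cls_eq_iff[OF assms(1) p] by blast
  qed
qed

definition inverse_word :: "word \<Rightarrow> word" where
  "inverse_word r = (SOME x. x \<in> lists A \<and> cls x = inv\<^bsub>M\<^esub> (cls r))"

lemma inverse_word:
  assumes "r \<in> \<Delta>"
  shows "inverse_word r \<in> lists A" "cls (inverse_word r) = inv\<^bsub>M\<^esub> (cls r)"
proof -
  have "inv\<^bsub>M\<^esub> (cls r) \<in> carrier M" using piece_unit[OF assms] by simp
  then have "\<exists>x. x \<in> lists A \<and> cls x = inv\<^bsub>M\<^esub> (cls r)"
    by (metis carrier_one_relator_monoidE)
  from someI_ex[OF this] show "inverse_word r \<in> lists A" "cls (inverse_word r) = inv\<^bsub>M\<^esub> (cls r)"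
    by (simp_all add: inverse_word_def)
qed

definition right_inverse :: "word \<Rightarrow> word" where
  "right_inverse r = tl r @ inverse_word r"

text \<open>The normal form of the right inverse; the case distinction is due to pieces that represent the
  identity, whose inverse is not written.\<close>

definition right_inverse_nf :: "word \<Rightarrow> mixed" where
  "right_inverse_nf r =
     map Inl (tl r) @ (if cls r = \<one>\<^bsub>M\<^esub> then [] else [Inr (inv\<^bsub>M\<^esub> (cls r))])"

abbreviation \<Phi> :: "word list \<Rightarrow> word" where "\<Phi> v \<equiv> concat (map right_inverse v)"
abbreviation \<Psi> :: "word list \<Rightarrow> mixed" where "\<Psi> v \<equiv> concat (map right_inverse_nf v)"

lemma right_inverse_in: "r \<in> G \<Longrightarrow> right_inverse r \<in> lists A"
  using piece_in inverse_word(1) by (elim GE) (force simp: right_inverse_def)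

lemma \<Phi>_in: "v \<in> lists G \<Longrightarrow> \<Phi> v \<in> lists A"
  using right_inverse_in by fastforce

text \<open>The second claim is condition C3: the second letter of a piece in \<open>G\<close> differs from \<open>a\<close>.\<close>

lemma \<Psi>_first_symbol:
  assumes "v \<in> lists G"
  shows "\<Psi> v \<noteq> Inr u # X" "\<Psi> v \<noteq> Inl a # X"
  using assms by (cases v; force simp: right_inverse_nf_def elim!: GE)+

lemma unit_act_no_unit:
  assumes "\<And>v Y. X \<noteq> Inr v # Y"
  shows "unit_act u X = (if u = \<one>\<^bsub>M\<^esub> then X else Inr u # X)"
  using assms by (cases "(u, X)" rule: unit_act.cases) auto

lemma act_inverse_word:
  assumes "r \<in> \<Delta>" "normal X"
  shows "act (inverse_word r) X = unit_act (inv\<^bsub>M\<^esub> (cls r)) X"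
proof -
  let ?Y = "act (inverse_word r) X"
  note r = piece_unit[OF assms(1)] and i = inverse_word[OF assms(1)]
  have Y: "normal ?Y" using normal_act i assms(2) by blast
  have "cls (r @ inverse_word r) = cls []"
    using r i piece_in[OF assms(1)] by (simp add: cls_append cls_Nil)
  then have "r @ inverse_word r \<approx> []" using cls_eq_iff i piece_in[OF assms(1)] by simp
  from act_cong[OF this assms(2)] have "unit_act (cls r) ?Y = X" using act_piece[OF assms(1)] by simp
  then show ?thesis using unit_act_mult[OF Y, of "inv\<^bsub>M\<^esub> (cls r)" "cls r"] r unit_act_one[OF Y] by simp
qed

lemma inv_eq_one: "u \<in> Units M \<Longrightarrow> inv\<^bsub>M\<^esub> u = \<one>\<^bsub>M\<^esub> \<longleftrightarrow> u = \<one>\<^bsub>M\<^esub>"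
  by (metis Units_inv_inv inv_one)

text \<open>Multiplying right inverses just concatenates their normal forms: each starts with a letter, so the
  unit at the end of its predecessor is not absorbed, and the letters of \<open>tl r\<close> form a proper suffix of
  a piece.\<close>

lemma nf_\<Phi>: "v \<in> lists G \<Longrightarrow> nf (\<Phi> v) = \<Psi> v"
proof (induction v)
  case (Cons r v)
  then have r: "r \<in> G" "v \<in> lists G" by auto
  then obtain b q where bq: "r = a # b # q" "r \<in> \<Delta>" by (auto elim: GE)
  have n: "normal (\<Psi> v)" using Cons normal_nf[OF \<Phi>_in[OF r(2)]] by simp
  have "act (tl r) X = map Inl (tl r) @ X" for X
    using act_suffix[of "[a]" "tl r" X] bq by simp
  then show ?case
    using Cons.IH[OF r(2)] act_inverse_word[OF bq(2) n]
      unit_act_no_unit[OF \<Psi>_first_symbol(1)[OF r(2)]] inv_eq_one[OF piece_unit[OF bq(2)]]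
    by (simp add: right_inverse_def[of r] right_inverse_nf_def[of r])
qed simp

lemma \<Psi>_eq_Nil_iff: "v \<in> lists G \<Longrightarrow> \<Psi> v = [] \<longleftrightarrow> v = []"
  by (cases v) (auto simp: right_inverse_nf_def elim: GE)

text \<open>Putting \<open>a\<close> in front of a concatenation exhibits the piece the first factor stems from, and no
  two pieces are prefixes of the same word.\<close>

lemma \<Psi>_inj:
  assumes "v \<in> lists G" "v' \<in> lists G" "\<Psi> v = \<Psi> v'"
  shows "v = v'"
  using assms
proof (induction v arbitrary: v' rule: list.induct)
  case Nil
  then show ?case using \<Psi>_eq_Nil_iff by (metis concat.simps(1) list.simps(8))
next
  case (Cons r v)
  then have r: "r \<in> G" by auto
  have "v' \<noteq> []" using \<Psi>_eq_Nil_iff[OF Cons.prems(1)] \<Psi>_eq_Nil_iff[OF Cons.prems(2)] Cons.prems(3)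
    by (metis list.distinct(1))
  then obtain s u where v': "v' = s # u" by (cases v') auto
  then have s: "s \<in> G" using Cons.prems by auto
  have pre: "prefix (map Inl t :: mixed) (Inl a # right_inverse_nf t @ X)" if "t \<in> G" for t X
    using that by (rule GE) (simp add: right_inverse_nf_def)
  have eq: "right_inverse_nf r @ \<Psi> v = right_inverse_nf s @ \<Psi> u" using Cons.prems(3) v' by simp
  have "r \<in> \<Delta>" "s \<in> \<Delta>" using r s by (auto simp: G_def)
  then have "r = s" using prefix_map_pieces_eq pre[OF r, of "\<Psi> v"] pre[OF s, of "\<Psi> u"] eq by metis
  then show ?case using Cons.IH[of u] Cons.prems v' by auto
qed

lemma \<Phi>_inj:
  assumes "v \<in> lists G" "v' \<in> lists G" "\<Phi> v \<approx> \<Phi> v'"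
  shows "v = v'"
  using \<Psi>_inj[OF assms(1,2)] act_cong[OF assms(3), of "[]"] nf_\<Phi> assms(1,2) by simp

lemma cls_\<Phi>: "v \<in> lists G \<Longrightarrow> eval_mixed (\<Psi> v) = cls (\<Phi> v)"
  using eval_nf[OF \<Phi>_in] nf_\<Phi> by metis

text \<open>One step of cancelling a power of \<open>a\<close>. The letter \<open>a\<close> must have reduced, because by condition C3
  no product of right inverses has a normal form starting with \<open>a\<close>. It reduced with some piece \<open>r\<close>
  in \<open>G\<close>, and undoing the multiplication with the unit of \<open>r\<close> shows that \<open>X\<close> begins with the right
  inverse belonging to \<open>r\<close>.\<close>

lemma letter_act_a_eq_\<Psi>:
  assumes "normal X" "letter_act a X = \<Psi> v" "v \<in> lists G"
  shows "\<exists>r\<in>G. X = right_inverse_nf r @ \<Psi> v"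
proof (cases a X rule: letter_act_cases)
  case (reduce r Y)
  then have "r \<in> G" using piece_not_Nil[OF reduce(1)] by (cases r) (auto simp: G_def)
  then obtain b q where r: "r = a # b # q" by (rule GE)
  have X: "X = map Inl (tl r) @ Y" using reduce(2) r by simp
  then have Y: "normal Y" using assms(1) normal_append by blast
  note u = piece_unit[OF reduce(1)]
  have "unit_act (cls r) Y = \<Psi> v" using reduce(3) assms(2) by simp
  then have "Y = unit_act (inv\<^bsub>M\<^esub> (cls r)) (\<Psi> v)"
    using unit_act_mult[OF Y, of "inv\<^bsub>M\<^esub> (cls r)" "cls r"] u unit_act_one[OF Y] by simp
  then have "X = right_inverse_nf r @ \<Psi> v"
    using X unit_act_no_unit[OF \<Psi>_first_symbol(1)[OF assms(3)]] inv_eq_one[OF u]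
    by (simp add: right_inverse_nf_def)
  then show ?thesis using \<open>r \<in> G\<close> by blast
next
  case irreducible
  then show ?thesis using \<Psi>_first_symbol(2)[OF assms(3)] assms(2) by metis
qed

lemma annihilated_by_power:
  assumes "x \<in> lists A" "replicate n a @ x \<approx> []"
  shows "\<exists>v\<in>lists G. length v = n \<and> x \<approx> \<Phi> v"
proof -
  have *: "\<exists>v\<in>lists G. length v = n \<and> X = \<Psi> v"
    if "normal X" "(letter_act a ^^ n) X = []" for X n
    using that
  proof (induction n arbitrary: X)
    case 0
    then show ?case by (intro bexI[of _ "[]"]) auto
  next
    case (Suc n)
    then have "(letter_act a ^^ n) (letter_act a X) = []"
      by (simp only: funpow_Suc_right comp_apply)
    from Suc.IH[OF normal_letter_act[OF Suc.prems(1) a_in] this]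
    obtain v where v: "v \<in> lists G" "length v = n" "letter_act a X = \<Psi> v" by blast
    obtain r where "r \<in> G" "X = \<Psi> (r # v)"
      using letter_act_a_eq_\<Psi>[OF Suc.prems(1) v(3,1)] by auto
    then show ?case using v by (intro bexI[of _ "r # v"]) auto
  qed
  have "act (replicate n a) X = (letter_act a ^^ n) X" for X
    by (induction n) simp_all
  then have "(letter_act a ^^ n) (nf x) = []"
    using act_cong[OF assms(2), of "[]"] by simp
  from *[OF normal_nf[OF assms(1)] this] obtain v where
    v: "v \<in> lists G" "length v = n" "nf x = \<Psi> v" by blast
  then have "cls x = cls (\<Phi> v)" using eval_nf[OF assms(1)] cls_\<Phi> by metis
  then show ?thesis using v cls_eq_iff[OF assms(1) \<Phi>_in] by blast
qed

lemma power_annihilates: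
  assumes "v \<in> lists G"
  shows "replicate (length v) a @ \<Phi> v \<approx> []"
  using assms
proof (induction v)
  case Nil
  show ?case by (auto intro: relator_cong.refl)
next
  case (Cons r v)
  then have r: "r \<in> G" "v \<in> lists G" by auto
  then obtain b q where bq: "r = a # b # q" "r \<in> \<Delta>" by (auto elim: GE)
  note i = inverse_word[OF bq(2)]
  have "cls (r @ inverse_word r) = cls []"
    using piece_unit[OF bq(2)] i piece_in[OF bq(2)] by (simp add: cls_append cls_Nil)
  then have "r @ inverse_word r \<approx> []" using cls_eq_iff i piece_in[OF bq(2)] by simp
  moreover have "r @ inverse_word r = [a] @ right_inverse r" using bq by (simp add: right_inverse_def)
  ultimately have 1: "[a] @ right_inverse r \<approx> []" by simp
  have p: "replicate n a \<in> lists A" for n using a_in by auto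
  have "replicate (length v) a @ ([a] @ right_inverse r) @ \<Phi> v \<approx> replicate (length v) a @ [] @ \<Phi> v"
    using p \<Phi>_in[OF r(2)] 1 by (intro relator_cong.append) (auto intro: relator_cong.refl)
  also have "replicate (length v) a @ [] @ \<Phi> v = replicate (length v) a @ \<Phi> v" by simp
  finally have "replicate (length v) a @ ([a] @ right_inverse r) @ \<Phi> v \<approx> []"
    using Cons.IH relator_cong.trans by blast
  then show ?case by (simp add: replicate_app_Cons_same)
qed

end

section \<open>Translating systems with length constraints\<close>

text \<open>Fresh variables are tagged codes: tags 0 and 1 mark the two variables belonging to a variable
  \<open>x\<close>, one for its value \<open>X\<close> and one for a power \<open>z\<close> of \<open>a\<close> with \<open>z^k X = 1\<close>; tags 2 and 3 mark the two
  variables belonging to a length constraint, powers of \<open>a\<close> measuring the length of the left side and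
  the excess of the right side over it. Constraints are identified by their codes and not by their
  positions, so that the translation is a plain concatenation over the system. The name \<open>2 * x\<close> instead of \<open>x\<close> is
  the code of the symbol \<open>Var x\<close>, which thus need not be decoded.\<close>

definition word_var :: "nat \<Rightarrow> symbol" where
  "word_var x = Var (prod_encode (0, 2 * x))"

definition block_var :: "nat \<Rightarrow> symbol" where
  "block_var x = Var (prod_encode (1, 2 * x))"

definition length_var :: "symbol list \<Rightarrow> symbol list \<Rightarrow> symbol" where
  "length_var l r = Var (prod_encode (2, prod_encode (encode_term l, encode_term r)))"

definition excess_var :: "symbol list \<Rightarrow> symbol list \<Rightarrow> symbol" where
  "excess_var l r = Var (prod_encode (3, prod_encode (encode_term l, encode_term r)))"

definition commute_eq :: "nat \<Rightarrow> symbol \<Rightarrow> equation" where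
  "commute_eq a z = ([z, Letter a], [Letter a, z])"

fun translate_symbol :: "(nat \<Rightarrow> word) \<Rightarrow> symbol \<Rightarrow> symbol list" where
  "translate_symbol code (Var x) = [word_var x]"
| "translate_symbol code (Letter s) = map Letter (code s)"

definition translate :: "(nat \<Rightarrow> word) \<Rightarrow> symbol list \<Rightarrow> symbol list" where
  "translate code t = concat (map (translate_symbol code) t)"

text \<open>The two equations say that the value of \<open>x\<close> is a product of blocks of length \<open>k\<close>.\<close>

fun symbol_conditions :: "nat \<Rightarrow> nat \<Rightarrow> symbol \<Rightarrow> equation list" where
  "symbol_conditions a k (Var x) =
     [commute_eq a (block_var x), (replicate k (block_var x) @ [word_var x], [])]"
| "symbol_conditions a k (Letter s) = []"

definition conditions :: "nat \<Rightarrow> nat \<Rightarrow> symbol list \<Rightarrow> equation list" where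
  "conditions a k t = concat (map (symbol_conditions a k) t)"

fun translate_equation :: "nat \<Rightarrow> nat \<Rightarrow> (nat \<Rightarrow> word) \<Rightarrow> equation \<Rightarrow> equation list" where
  "translate_equation a k code (l, r) =
     (translate code l, translate code r) # conditions a k l @ conditions a k r"

fun translate_length :: "nat \<Rightarrow> nat \<Rightarrow> (nat \<Rightarrow> word) \<Rightarrow> equation \<Rightarrow> equation list" where
  "translate_length a k code (l, r) =
     commute_eq a (length_var l r) # commute_eq a (excess_var l r) #
     (length_var l r # translate code l, []) #
     (length_var l r # excess_var l r # translate code r, []) #
     conditions a k l @ conditions a k r"

definition translate_system ::
  "nat \<Rightarrow> nat \<Rightarrow> (nat \<Rightarrow> word) \<Rightarrow> equation list \<Rightarrow> equation list \<Rightarrow> equation list" where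
  "translate_system a k code E L =
     concat (map (translate_equation a k code) E) @ concat (map (translate_length a k code) L)"

section \<open>Computability of the translation\<close>

text \<open>Agreement is required on the codes of members of \<open>X\<close> only, as letters outside the finite alphabet
  are translated arbitrarily.\<close>

lemma recursive_concat_map_encoded:
  assumes "recursive g" "\<And>x. x \<in> X \<Longrightarrow> g (e x) = list_encode (map e' (h x))"
  obtains F where "recursive F"
    "\<And>xs. xs \<in> lists X \<Longrightarrow> F (list_encode (map e xs)) = list_encode (map e' (concat (map h xs)))"
proof
  let ?F = "\<lambda>n. list_encode (concat (map (\<lambda>x. list_decode (g x)) (list_decode n)))"
  show "recursive ?F" by (rule recursive_concat_map[OF assms(1) recursive_id])
  fix xs assume "xs \<in> lists X"
  then have "concat (map (\<lambda>x. list_decode (g (e x))) xs) = map e' (concat (map h xs))"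
    by (induction xs) (simp_all add: assms(2))
  then show "?F (list_encode (map e xs)) = list_encode (map e' (concat (map h xs)))"
    by (simp add: comp_def)
qed

lemma recursive_replicate_append:
  assumes "recursive f" "recursive g"
  shows "recursive (\<lambda>n. list_encode (replicate k (f n) @ list_decode (g n)))"
  using assms by (induction k) (auto intro: recursive_Suc recursive.pair)

lemmas recursive_intros = recursive_id recursive_const recursive_fst recursive_snd recursive_Suc
  recursive.pair recursive_double recursive_replicate_append recursive_append

lemma encode_Var: "encode_symbol (Var x) = 2 * x"
  by (simp add: sum_encode_def)

lemma encode_Letter: "encode_symbol (Letter s) = Suc (2 * s)"
  by (simp add: sum_encode_def)

text \<open>Variables have even codes and letters odd ones.\<close>

lemma recursive_translate_term:
  assumes "finite S"
  obtains F where "recursive F"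
    "\<And>t. t \<in> terms_over S \<Longrightarrow> F (encode_term t) = encode_term (translate code t)"
proof -
  obtain N where "\<forall>n\<in>(\<lambda>s. Suc (2 * s)) ` S. n < N"
    using finite_nat_set_iff_bounded assms by blast
  then have N: "Suc (2 * s) < N" if "s \<in> S" for s using that by simp
  obtain f where f: "recursive f"
    "\<forall>n<N. f n = list_encode (map encode_symbol (map Letter (code (n div 2))))"
    using recursive_table[of N "\<lambda>n. list_encode (map encode_symbol (map Letter (code (n div 2))))"]
    by (elim exE conjE)
  let ?g = "\<lambda>n. if n mod 2 = 0 then Suc (prod_encode (2 * prod_encode (0, n), 0)) else f n"
  have "recursive ?g"
    by (intro recursive_if_zero recursive_parity f(1) recursive_intros)
  moreover have "?g (encode_symbol y) = list_encode (map encode_symbol (translate_symbol code y))"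
    if "y \<in> range Var \<union> Letter ` S" for y
    using that f(2) N by (auto simp: encode_Var encode_Letter word_var_def simp del: encode_symbol.simps)
  ultimately show ?thesis
    by (rule recursive_concat_map_encoded[where X = "range Var \<union> Letter ` S" and e = encode_symbol])
      (assumption, rule that, simp_all add: terms_over_def translate_def encode_term_def)
qed

abbreviation encode_equation :: "equation \<Rightarrow> nat" where
  "encode_equation \<equiv> \<lambda>(l, r). prod_encode (encode_term l, encode_term r)"

lemma recursive_conditions:
  obtains F where "recursive F" "\<And>t. F (encode_term t) = encode_system (conditions a k t)"
proof -
  let ?z = "\<lambda>n. 2 * prod_encode (1, n)"
  let ?g = "\<lambda>n. if n mod 2 = 0 then
      Suc (prod_encode (prod_encode (Suc (prod_encode (?z n, Suc (prod_encode (Suc (2 * a), 0)))),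
          Suc (prod_encode (Suc (2 * a), Suc (prod_encode (?z n, 0))))),
        Suc (prod_encode (prod_encode (list_encode (replicate k (?z n) @
          list_decode (Suc (prod_encode (2 * prod_encode (0, n), 0)))), 0), 0)))) else 0"
  have "recursive ?g"
    by (intro recursive_if_zero recursive_parity recursive_intros)
  moreover have "?g (encode_symbol y) = list_encode (map encode_equation (symbol_conditions a k y))"
    if "y \<in> UNIV" for y
    by (cases y) (auto simp: encode_Var encode_Letter word_var_def block_var_def commute_eq_def
        encode_term_def simp del: encode_symbol.simps)
  ultimately show ?thesis
    by (rule recursive_concat_map_encoded[where X = UNIV and e = encode_symbol])
      (assumption, rule that, simp_all add: conditions_def encode_term_def encode_system_def)
qed

lemma recursive_translate_system:
  assumes "finite S"
  obtains F where "recursive F"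
    "\<And>E L. E \<in> systems_over S \<Longrightarrow> L \<in> systems_over S \<Longrightarrow>
       F (prod_encode (encode_system E, encode_system L)) = encode_system (translate_system a k code E L)"
proof -
  obtain T where T: "recursive T"
    "\<And>t. t \<in> terms_over S \<Longrightarrow> T (encode_term t) = encode_term (translate code t)"
    using recursive_translate_term[OF assms] by blast
  obtain C where C: "recursive C" "\<And>t. C (encode_term t) = encode_system (conditions a k t)"
    using recursive_conditions by blast
  note TC = recursive.comp[OF T(1)] recursive.comp[OF C(1)]
  let ?l = "\<lambda>n. fst (prod_decode n)" and ?r = "\<lambda>n. snd (prod_decode n)"
  let ?c = "\<lambda>n. list_encode (list_decode (C (?l n)) @ list_decode (C (?r n)))"
  let ?g = "\<lambda>n. Suc (prod_encode (prod_encode (T (?l n), T (?r n)), ?c n))"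
  have "recursive ?g"
    by (intro recursive_Suc recursive.pair recursive_append TC recursive.left recursive.right)
  moreover have "?g (encode_equation e) = list_encode (map encode_equation (translate_equation a k code e))"
    if "e \<in> terms_over S \<times> terms_over S" for e
    using that T(2) C(2) by (auto simp: encode_system_def)
  ultimately obtain F1 where F1: "recursive F1" "\<And>E. E \<in> systems_over S \<Longrightarrow>
      F1 (encode_system E) = encode_system (concat (map (translate_equation a k code) E))"
    by (rule recursive_concat_map_encoded[where X = "terms_over S \<times> terms_over S" and e = encode_equation])
      (assumption, simp add: systems_over_def encode_system_def)
  let ?z = "\<lambda>n. 2 * prod_encode (2, n)" and ?y = "\<lambda>n. 2 * prod_encode (3, n)"
  let ?comm = "\<lambda>z. prod_encode (Suc (prod_encode (z, Suc (prod_encode (Suc (2 * a), 0)))),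
          Suc (prod_encode (Suc (2 * a), Suc (prod_encode (z, 0)))))"
  let ?h = "\<lambda>n. Suc (prod_encode (?comm (?z n), Suc (prod_encode (?comm (?y n),
      Suc (prod_encode (prod_encode (Suc (prod_encode (?z n, T (?l n))), 0),
      Suc (prod_encode (prod_encode (Suc (prod_encode (?z n, Suc (prod_encode (?y n, T (?r n))))), 0),
      ?c n))))))))"
  have "recursive ?h"
    by (intro recursive_Suc recursive.pair recursive_append recursive_double recursive_const
        recursive_id TC recursive.left recursive.right)
  moreover have "?h (encode_equation e) = list_encode (map encode_equation (translate_length a k code e))"
    if "e \<in> terms_over S \<times> terms_over S" for e
    using that T(2) C(2)
    by (auto simp: encode_system_def encode_Var encode_Letter length_var_def excess_var_def
        commute_eq_def encode_term_def simp del: encode_symbol.simps)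
  ultimately obtain F2 where F2: "recursive F2" "\<And>E. E \<in> systems_over S \<Longrightarrow>
      F2 (encode_system E) = encode_system (concat (map (translate_length a k code) E))"
    by (rule recursive_concat_map_encoded[where X = "terms_over S \<times> terms_over S" and e = encode_equation])
      (assumption, simp add: systems_over_def encode_system_def)
  show ?thesis
  proof
    show "recursive (\<lambda>n. list_encode (list_decode (F1 (?l n)) @ list_decode (F2 (?r n))))"
      by (intro recursive_append recursive.comp[OF F1(1)] recursive.comp[OF F2(1)] recursive.left recursive.right)
    fix E L assume "E \<in> systems_over S" "L \<in> systems_over S"
    then show "list_encode (list_decode (F1 (?l (prod_encode (encode_system E, encode_system L)))) @
        list_decode (F2 (?r (prod_encode (encode_system E, encode_system L))))) =
      encode_system (translate_system a k code E L)"
      by (simp add: F1(2) F2(2)) (simp add: encode_system_def translate_system_def)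
  qed
qed

section \<open>Solutions of the translated system\<close>

lemma subst_simps [simp]:
  "subst \<tau> [] = []" "subst \<tau> (y # t) = subst_symbol \<tau> y @ subst \<tau> t"
  "subst \<tau> (s @ t) = subst \<tau> s @ subst \<tau> t"
  by (simp_all add: subst_def)

lemma subst_replicate: "subst \<tau> (replicate k y) = concat (replicate k (subst_symbol \<tau> y))"
  by (simp add: subst_def)

lemma subst_map_Letter: "subst \<tau> (map Letter x) = x"
  by (induction x) simp_all

lemma terms_over_simps [simp]:
  "[] \<in> terms_over A" "y # t \<in> terms_over A \<longleftrightarrow> y \<in> range Var \<union> Letter ` A \<and> t \<in> terms_over A"
  "s @ t \<in> terms_over A \<longleftrightarrow> s \<in> terms_over A \<and> t \<in> terms_over A"
  by (auto simp: terms_over_def)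

lemma subst_in_lists:
  assumes "\<And>x. \<tau> x \<in> lists A"
  shows "y \<in> range Var \<union> Letter ` A \<Longrightarrow> subst_symbol \<tau> y \<in> lists A"
    "t \<in> terms_over A \<Longrightarrow> subst \<tau> t \<in> lists A"
proof -
  show *: "subst_symbol \<tau> y \<in> lists A" if "y \<in> range Var \<union> Letter ` A" for y
    using that assms[unfolded in_lists_conv_set] by auto
  show "t \<in> terms_over A \<Longrightarrow> subst \<tau> t \<in> lists A"
    by (induction t) (simp_all add: *)
qed

lemma eval_term_represented:
  assumes "w \<in> lists A" "t \<in> terms_over A" "\<And>x. \<tau> x \<in> lists A"
  shows "eval_term A w (\<lambda>x. represented A w (\<tau> x)) t = represented A w (subst \<tau> t)"
  using assms(2)
proof (induction t)
  case Nil
  then show ?case by (simp add: eval_term_def one_one_relator_monoid)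
next
  case (Cons y t)
  have "subst_symbol \<tau> y \<in> lists A" "subst \<tau> t \<in> lists A"
    using Cons.prems subst_in_lists[of \<tau>] assms(3) by simp_all
  moreover have "eval_symbol A w (\<lambda>x. represented A w (\<tau> x)) y = represented A w (subst_symbol \<tau> y)"
    by (cases y) simp_all
  ultimately show ?case
    using Cons mult_represented[OF assms(1)] by (simp add: eval_term_def)
qed

text \<open>Solutions in the monoid are handled through representing words, so that both kinds of systems are
  evaluated by \<^const>\<open>subst\<close>.\<close>

lemma system_solvable_iff:
  assumes "w \<in> lists A" "E \<in> systems_over A"
  shows "system_solvable A w E \<longleftrightarrow>
    (\<exists>\<tau>. (\<forall>x. \<tau> x \<in> lists A) \<and> (\<forall>(l, r)\<in>set E. (subst \<tau> l, subst \<tau> r) \<in> relator_cong A w))"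
proof -
  have *: "eval_term A w (\<lambda>x. represented A w (\<tau> x)) l = eval_term A w (\<lambda>x. represented A w (\<tau> x)) r
      \<longleftrightarrow> (subst \<tau> l, subst \<tau> r) \<in> relator_cong A w"
    if "(l, r) \<in> set E" "\<And>x. \<tau> x \<in> lists A" for \<tau> l r
  proof -
    have "l \<in> terms_over A" "r \<in> terms_over A" using that(1) assms(2) by (auto simp: systems_over_def)
    then show ?thesis
      using that(2) assms(1) by (simp add: eval_term_represented represented_eq_iff subst_in_lists)
  qed
  show ?thesis
  proof
    assume "system_solvable A w E"
    then obtain \<sigma> where \<sigma>: "\<forall>x. \<sigma> x \<in> carrier (one_relator_monoid A w)"
      "\<forall>(l, r)\<in>set E. eval_term A w \<sigma> l = eval_term A w \<sigma> r" by (auto simp: system_solvable_def)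
    have "\<forall>x. \<exists>u. u \<in> lists A \<and> \<sigma> x = represented A w u"
      using \<sigma>(1) by (meson carrier_one_relator_monoidE)
    then obtain \<tau> where \<tau>: "\<forall>x. \<tau> x \<in> lists A \<and> \<sigma> x = represented A w (\<tau> x)" by metis
    then have "\<sigma> = (\<lambda>x. represented A w (\<tau> x))" by auto
    then show "\<exists>\<tau>. (\<forall>x. \<tau> x \<in> lists A) \<and> (\<forall>(l, r)\<in>set E. (subst \<tau> l, subst \<tau> r) \<in> relator_cong A w)"
      using \<sigma>(2) \<tau> * by (intro exI[of _ \<tau>]) blast
  next
    assume "\<exists>\<tau>. (\<forall>x. \<tau> x \<in> lists A) \<and> (\<forall>(l, r)\<in>set E. (subst \<tau> l, subst \<tau> r) \<in> relator_cong A w)"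
    then obtain \<tau> where \<tau>: "\<forall>x. \<tau> x \<in> lists A"
      "\<forall>(l, r)\<in>set E. (subst \<tau> l, subst \<tau> r) \<in> relator_cong A w" by blast
    have "\<forall>(l, r)\<in>set E. eval_term A w (\<lambda>x. represented A w (\<tau> x)) l
        = eval_term A w (\<lambda>x. represented A w (\<tau> x)) r"
      using * \<tau> by blast
    moreover have "\<forall>x. represented A w (\<tau> x) \<in> carrier (one_relator_monoid A w)"
      using \<tau>(1) represented_in_carrier by blast
    ultimately show "system_solvable A w E"
      unfolding system_solvable_def by (intro exI[of _ "\<lambda>x. represented A w (\<tau> x)"] conjI)
  qed
qed

lemma translate_system_in:
  assumes "a \<in> A" "\<And>s. s \<in> S \<Longrightarrow> code s \<in> lists A" "E \<in> systems_over S" "L \<in> systems_over S"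
  shows "translate_system a k code E L \<in> systems_over A"
proof -
  have t: "translate code t \<in> terms_over A" if "t \<in> terms_over S" for t
    using that assms(2)[unfolded in_lists_conv_set]
    by (induction t) (auto simp: translate_def word_var_def, auto simp: terms_over_def)
  have "replicate k (Var x) \<in> terms_over A" for x by (auto simp: terms_over_def)
  then have c: "set (conditions a k t) \<subseteq> terms_over A \<times> terms_over A" for t
  proof (induction t)
    case (Cons y t)
    then show ?case using assms(1)
      by (cases y) (auto simp: conditions_def commute_eq_def block_var_def word_var_def)
  qed (simp add: conditions_def)
  have "set (translate_equation a k code e) \<subseteq> terms_over A \<times> terms_over A"
      "set (translate_length a k code e) \<subseteq> terms_over A \<times> terms_over A"
    if "e \<in> terms_over S \<times> terms_over S" for e
    using that t assms(1)
    by (auto simp: commute_eq_def length_var_def excess_var_def dest: c[THEN subsetD])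
  then show ?thesis
    using assms(3,4) unfolding systems_over_def translate_system_def in_lists_conv_set by fastforce
qed

lemma inj_encode_symbol: "inj encode_symbol"
proof (rule injI)
  fix x y assume "encode_symbol x = encode_symbol y"
  then show "x = y" by (cases x; cases y) (simp_all del: sum_encode_def add: sum_encode_eq)
qed

lemma inj_encode_term: "inj encode_term"
  by (rule injI) (simp add: encode_term_def list_encode_eq inj_map_eq_map[OF inj_encode_symbol])

lemma concat_replicate_replicate: "concat (replicate k (replicate n a)) = replicate (k * n) a"
  by (induction k) (simp_all add: replicate_add)

definition blocks :: "'a set \<Rightarrow> nat \<Rightarrow> 'a list set" where
  "blocks X k = {v \<in> lists X. length v = k}"

lemma concat_blocks:
  assumes "u \<in> lists (blocks X k)"
  shows "concat u \<in> lists X" "length (concat u) = k * length u"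
  using assms by (induction u) (auto simp: blocks_def)

lemma split_into_blocks:
  assumes "v \<in> lists X" "length v = k * n"
  shows "\<exists>u\<in>lists (blocks X k). concat u = v"
  using assms
proof (induction n arbitrary: v)
  case 0
  then show ?case by (intro bexI[of _ "[]"]) auto
next
  case (Suc n)
  have "drop k v \<in> lists X" "take k v \<in> lists X"
    using Suc.prems(1) by (auto simp: in_lists_conv_set dest: in_set_takeD in_set_dropD)
  moreover from this Suc obtain u where "u \<in> lists (blocks X k)" "concat u = drop k v"
    by (metis add_diff_cancel_left' length_drop mult_Suc_right)
  ultimately show ?case
    using Suc.prems(2) by (intro bexI[of _ "take k v # u"]) (auto simp: blocks_def)
qed

lemma concat_blocks_inj:
  assumes "u \<in> lists (blocks X k)" "u' \<in> lists (blocks X k)" "concat u = concat u'" "k > 0"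
  shows "u = u'"
proof (rule concat_injective[OF assms(3)])
  show "length u = length u'"
    using concat_blocks(2)[OF assms(1)] concat_blocks(2)[OF assms(2)] assms(3,4) by simp
  show "\<forall>(x, y)\<in>set (zip u u'). length x = length y"
    using assms(1,2) by (fastforce simp: blocks_def dest: set_zip_leftD set_zip_rightD)
qed

text \<open>There are \<open>2 ^ n\<close> words of length \<open>n = card S\<close> over two letters, at least as many as letters in \<open>S\<close>.\<close>

lemma exists_block_code:
  assumes "finite S" "x \<in> X" "y \<in> X" "x \<noteq> y"
  obtains c where "inj_on c S" "c ` S \<subseteq> blocks X (card S)"
proof -
  let ?B = "blocks {x, y} (card S)"
  have B: "?B = {v. set v \<subseteq> {x, y} \<and> length v = card S}" by (auto simp: blocks_def)
  have "card ?B = 2 ^ card S" using card_lists_length_eq[of "{x, y}" "card S"] assms(4) B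
    by (simp add: numeral_2_eq_2)
  moreover have "finite ?B" using finite_lists_length_eq[of "{x, y}" "card S"] B by simp
  moreover have "card S \<le> 2 ^ card S" by (rule less_imp_le[OF less_exp])
  ultimately obtain c where "c ` S \<subseteq> ?B" "inj_on c S"
    using card_le_inj[OF assms(1), of ?B] by auto
  moreover have "?B \<subseteq> blocks X (card S)" using assms(2,3) by (auto simp: blocks_def)
  ultimately show ?thesis using that by blast
qed

context overlapping_pieces
begin

lemma power_in: "replicate n a \<in> lists A"
  using a_in by auto

lemma cong_append_right: "u \<approx> v \<Longrightarrow> x \<in> lists A \<Longrightarrow> u @ x \<approx> v @ x"
  by (blast intro: relator_cong.append relator_cong.refl)

lemma concat_replicate_cong: "u \<approx> v \<Longrightarrow> concat (replicate k u) \<approx> concat (replicate k v)"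
  by (induction k) (auto intro: relator_cong.append relator_cong.refl)

lemma power_annihilates_only:
  assumes "v \<in> lists G" "replicate n a @ \<Phi> v \<approx> []"
  shows "n = length v"
  using annihilated_by_power[OF \<Phi>_in assms(2)] \<Phi>_inj assms(1) by blast

lemma annihilated_by_block_power:
  assumes "x \<in> lists A" "z \<in> lists A" "z @ [a] \<approx> [a] @ z" "concat (replicate k z) @ x \<approx> []"
  shows "\<exists>u\<in>lists (blocks G k). x \<approx> \<Phi> (concat u)"
proof -
  obtain n where "z \<approx> replicate n a" using centralizer assms(2,3) by blast
  from concat_replicate_cong[OF this, of k]
  have "concat (replicate k z) @ x \<approx> replicate (k * n) a @ x"
    using cong_append_right assms(1) by (simp add: concat_replicate_replicate)
  then have "replicate (k * n) a @ x \<approx> []"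
    using assms(4) relator_cong.trans relator_cong.sym by blast
  from annihilated_by_power[OF assms(1) this] show ?thesis
    using split_into_blocks by metis
qed

text \<open>A solution over \<open>S\<close> is translated letter by letter. Conversely, the values of the variables in a
  solution in the monoid are products of blocks, uniquely so; replacing blocks by the letters
  they code, and the remaining blocks by a fixed letter of \<open>S\<close>, is a homomorphism that undoes the
  coding of the constants, hence respects the equations, and it divides lengths by \<open>k\<close>.\<close>

lemma translate_system_solvable_iff:
  assumes c: "inj_on c S" "c ` S \<subseteq> blocks G k" and k: "k > 0" and S: "S \<noteq> {}"
    and E: "E \<in> systems_over S" and L: "L \<in> systems_over S"
  shows "system_solvable A w (translate_system a k (\<lambda>s. \<Phi> (c s)) E L)
    \<longleftrightarrow> length_system_solvable S (E, L)"
    (is "system_solvable A w ?T \<longleftrightarrow> _")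
proof -
  let ?code = "\<lambda>s. \<Phi> (c s)"
  have cG: "c s \<in> lists G" "length (c s) = k" if "s \<in> S" for s
    using c(2) that by (auto simp: blocks_def)
  have T: "?T \<in> systems_over A"
    using \<Phi>_in cG by (intro translate_system_in[OF a_in _ E L]) blast
  have el: "l \<in> terms_over S" "r \<in> terms_over S" if "(l, r) \<in> set E \<or> (l, r) \<in> set L" for l r
    using that E L by (auto simp: systems_over_def)
  show ?thesis
  proof
    assume "system_solvable A w ?T"
    then obtain \<tau> where \<tau>: "\<And>x. \<tau> x \<in> lists A"
      and eqs: "\<And>l r. (l, r) \<in> set ?T \<Longrightarrow> subst \<tau> l \<approx> subst \<tau> r"
      using system_solvable_iff[OF w_in T] by blast
    \<comment> \<open>Nothing is known about variables that do not occur in the system, so the product of blocks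
      \<open>U x\<close> is meaningful only for good \<open>x\<close>.\<close>
    let ?good = "\<lambda>x. \<exists>u\<in>lists (blocks G k). subst_symbol \<tau> (word_var x) \<approx> \<Phi> (concat u)"
    have "\<forall>x. \<exists>u. u \<in> lists (blocks G k) \<and>
        (?good x \<longrightarrow> subst_symbol \<tau> (word_var x) \<approx> \<Phi> (concat u))"
      by blast
    then obtain U where U: "\<And>x. U x \<in> lists (blocks G k)"
        "\<And>x. ?good x \<Longrightarrow> subst_symbol \<tau> (word_var x) \<approx> \<Phi> (concat (U x))"
      by metis
    define V where "V t = concat (map (\<lambda>y. case y of Var x \<Rightarrow> U x | Letter s \<Rightarrow> [c s]) t)" for t
    obtain s0 where s0: "s0 \<in> S" using S by blast
    \<comment> \<open>\<open>d\<close> decodes a block; \<open>s0\<close> replaces the blocks that code no letter.\<close>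
    define d where "d v = (if v \<in> c ` S then inv_into S c v else s0)" for v
    have d: "d (c s) = s" if "s \<in> S" for s using that c(1) by (simp add: d_def)
    have dS: "d v \<in> S" for v using s0 by (auto simp: d_def intro: inv_into_into)
    define \<sigma> where "\<sigma> x = map d (U x)" for x
    have V: "V t \<in> lists (blocks G k)" "map d (V t) = subst \<sigma> t" if "t \<in> terms_over S" for t
      using that U(1)[unfolded in_lists_conv_set] c(2) d by (induction t) (auto simp: V_def \<sigma>_def)
    have good: "?good x"
      if "Var x \<in> set t" "set (conditions a k t) \<subseteq> set ?T" for t x
    proof (rule annihilated_by_block_power)
      have "commute_eq a (block_var x) \<in> set ?T"
        "(replicate k (block_var x) @ [word_var x], []) \<in> set ?T"
        using that by (force simp: conditions_def)+
      from this(1)[unfolded commute_eq_def, THEN eqs] this(2)[THEN eqs]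
      show "subst_symbol \<tau> (block_var x) @ [a] \<approx> [a] @ subst_symbol \<tau> (block_var x)"
        "concat (replicate k (subst_symbol \<tau> (block_var x))) @ subst_symbol \<tau> (word_var x) \<approx> []"
        by (simp_all add: subst_replicate)
    qed (simp_all add: block_var_def word_var_def \<tau>)
    have image: "subst \<tau> (translate ?code t) \<approx> \<Phi> (concat (V t))"
      if "t \<in> terms_over S" "set (conditions a k t) \<subseteq> set ?T" for t
    proof -
      have "subst \<tau> (translate ?code t) \<approx> \<Phi> (concat (V t))"
        if "t \<in> terms_over S" "\<And>x. Var x \<in> set t \<Longrightarrow> ?good x" for t
        using that
      proof (induction t)
        case Nil
        then show ?case by (auto simp: translate_def V_def intro: relator_cong.refl)
      next
        case (Cons y t)
        have "subst \<tau> (translate_symbol ?code y) \<approx> \<Phi> (concat (V [y]))"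
        proof (cases y)
          case (Var x)
          then show ?thesis using U(2) Cons.prems by (simp add: V_def)
        next
          case (Letter s)
          then have "s \<in> S" using Cons.prems(1) by auto
          from relator_cong.refl[OF \<Phi>_in[OF cG(1)[OF this]]]
          show ?thesis by (simp add: Letter V_def subst_map_Letter)
        qed
        moreover have "subst \<tau> (translate ?code t) \<approx> \<Phi> (concat (V t))" using Cons by simp
        ultimately have "subst \<tau> (translate_symbol ?code y) @ subst \<tau> (translate ?code t) \<approx>
            \<Phi> (concat (V [y])) @ \<Phi> (concat (V t))"
          by (rule relator_cong.append)
        then show ?case by (simp add: translate_def V_def)
      qed
      then show ?thesis using that good by blast
    qed
    have "subst \<sigma> l = subst \<sigma> r" if e: "(l, r) \<in> set E" for l r
    proof -
      have sub: "set (translate_equation a k ?code (l, r)) \<subseteq> set ?T"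
        using e by (force simp: translate_system_def)
      then have "subst \<tau> (translate ?code l) \<approx> subst \<tau> (translate ?code r)"
        by (intro eqs) auto
      moreover have "subst \<tau> (translate ?code l) \<approx> \<Phi> (concat (V l))"
        "subst \<tau> (translate ?code r) \<approx> \<Phi> (concat (V r))"
        using sub el e by (auto intro!: image)
      ultimately have "\<Phi> (concat (V l)) \<approx> \<Phi> (concat (V r))"
        using relator_cong.trans relator_cong.sym by blast
      then have "V l = V r"
        using \<Phi>_inj concat_blocks(1) concat_blocks_inj V(1) el e k by metis
      then show ?thesis using V(2) el e by metis
    qed
    moreover have "length (subst \<sigma> l) \<le> length (subst \<sigma> r)" if e: "(l, r) \<in> set L" for l r
    proof -
      have sub: "set (translate_length a k ?code (l, r)) \<subseteq> set ?T"
        using e by (force simp: translate_system_def)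
      let ?z = "subst_symbol \<tau> (length_var l r)" and ?y = "subst_symbol \<tau> (excess_var l r)"
      have zy: "?z \<in> lists A" "?y \<in> lists A" using \<tau> by (simp_all add: length_var_def excess_var_def)
      have "?z @ [a] \<approx> [a] @ ?z" "?y @ [a] \<approx> [a] @ ?y"
        using sub eqs[of "[length_var l r, Letter a]" "[Letter a, length_var l r]"]
          eqs[of "[excess_var l r, Letter a]" "[Letter a, excess_var l r]"]
        by (simp_all add: commute_eq_def)
      then obtain p q where pq: "?z \<approx> replicate p a" "?y \<approx> replicate q a"
        using centralizer zy by metis
      have l: "subst \<tau> (translate ?code l) \<approx> \<Phi> (concat (V l))"
        and r: "subst \<tau> (translate ?code r) \<approx> \<Phi> (concat (V r))"
        using sub el e by (auto intro!: image)
      have "?z @ subst \<tau> (translate ?code l) \<approx> []" "?z @ ?y @ subst \<tau> (translate ?code r) \<approx> []"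
        using sub eqs[of "length_var l r # translate ?code l" "[]"]
          eqs[of "length_var l r # excess_var l r # translate ?code r" "[]"]
        by simp_all
      then have "replicate p a @ \<Phi> (concat (V l)) \<approx> []"
        "replicate p a @ replicate q a @ \<Phi> (concat (V r)) \<approx> []"
        using relator_cong.append[OF pq(1) l] relator_cong.append[OF pq(1) relator_cong.append[OF pq(2) r]]
          relator_cong.trans relator_cong.sym by blast+
      then have "p = length (concat (V l))" "p + q = length (concat (V r))"
        using power_annihilates_only concat_blocks(1) V(1) el e
        by (metis, metis append_assoc replicate_add)
      then have "k * length (V l) \<le> k * length (V r)"
        using concat_blocks(2)[OF V(1)] el e by (metis le_add1)
      then have "length (map d (V l)) \<le> length (map d (V r))" using k by simp
      then show ?thesis using V(2) el e by metis
    qed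
    moreover have "\<sigma> x \<in> lists S" for x using dS by (auto simp: \<sigma>_def)
    ultimately show "length_system_solvable S (E, L)"
      unfolding length_system_solvable_def by blast
  next
    assume "length_system_solvable S (E, L)"
    then obtain \<sigma> where \<sigma>: "\<And>x. \<sigma> x \<in> lists S"
      and sE: "\<And>l r. (l, r) \<in> set E \<Longrightarrow> subst \<sigma> l = subst \<sigma> r"
      and sL: "\<And>l r. (l, r) \<in> set L \<Longrightarrow> length (subst \<sigma> l) \<le> length (subst \<sigma> r)"
      unfolding length_system_solvable_def by blast
    \<comment> \<open>The value of a fresh variable is found by decoding its name; \<open>len\<close> takes the code of a term.\<close>
    define len where "len m = k * length (subst \<sigma> (the_inv encode_term m))" for m
    define \<tau> where "\<tau> v = (let (i, m) = prod_decode v; (p, q) = prod_decode m in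
        if i = 0 then \<Phi> (concat (map c (\<sigma> (m div 2))))
        else if i = 1 then replicate (length (\<sigma> (m div 2))) a
        else if i = 2 then replicate (len p) a else replicate (len q - len p) a)" for v
    have len: "len (encode_term t) = k * length (subst \<sigma> t)" for t
      by (simp add: len_def the_inv_f_f[OF inj_encode_term])
    have \<tau>_simps: "subst_symbol \<tau> (word_var x) = \<Phi> (concat (map c (\<sigma> x)))"
      "subst_symbol \<tau> (block_var x) = replicate (length (\<sigma> x)) a"
      "subst_symbol \<tau> (length_var l r) = replicate (k * length (subst \<sigma> l)) a"
      "subst_symbol \<tau> (excess_var l r) =
        replicate (k * length (subst \<sigma> r) - k * length (subst \<sigma> l)) a" for x l r
      by (simp_all add: \<tau>_def word_var_def block_var_def length_var_def excess_var_def len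
          split: prod.split)
    have blk: "map c x \<in> lists (blocks G k)" if "x \<in> lists S" for x
      using that c(2) by (auto simp: image_subset_iff)
    note blk_G = concat_blocks(1)[OF blk] and blk_len = concat_blocks(2)[OF blk]
    have \<tau>_in: "\<tau> x \<in> lists A" for x
      using \<Phi>_in[OF blk_G[OF \<sigma>]] power_in by (simp add: \<tau>_def Let_def split: prod.split)
    have tr: "subst \<tau> (translate ?code t) = \<Phi> (concat (map c (subst \<sigma> t)))" for t
    proof (induction t)
      case (Cons y t)
      then show ?case by (cases y) (simp_all add: translate_def \<tau>_simps subst_map_Letter)
    qed (simp add: translate_def)
    have ann: "replicate (k * length x) a @ \<Phi> (concat (map c x)) \<approx> []" if "x \<in> lists S" for x
      using power_annihilates[OF blk_G[OF that]] blk_len[OF that] by simp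
    have sub_in: "subst \<sigma> t \<in> lists S" if "t \<in> terms_over S" for t
      using subst_in_lists(2)[of \<sigma>] \<sigma> that by blast
    have cond: "subst \<tau> l \<approx> subst \<tau> r" if "(l, r) \<in> set (conditions a k t)" for l r t
    proof -
      obtain y where "(l, r) \<in> set (symbol_conditions a k y)"
        using \<open>(l, r) \<in> set (conditions a k t)\<close> by (auto simp: conditions_def)
      then obtain x where "(l, r) = commute_eq a (block_var x) \<or>
          (l, r) = (replicate k (block_var x) @ [word_var x], [])"
        by (cases y) auto
      then show ?thesis
        using ann[OF \<sigma>, of x] relator_cong.refl[OF power_in[of "Suc (length (\<sigma> x))"], of w]
        by (auto simp: commute_eq_def subst_replicate \<tau>_simps concat_replicate_replicate replicate_append_same)
    qed
    have "subst \<tau> l' \<approx> subst \<tau> r'"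
      if e: "(l, r) \<in> set E" "(l', r') \<in> set (translate_equation a k ?code (l, r))" for l r l' r'
    proof -
      have "subst \<tau> (translate ?code l) \<approx> subst \<tau> (translate ?code r)"
        unfolding tr sE[OF e(1)]
        by (intro relator_cong.refl \<Phi>_in blk_G sub_in) (use el e(1) in blast)
      then show ?thesis using e(2) cond by auto
    qed
    moreover have "subst \<tau> l' \<approx> subst \<tau> r'"
      if e: "(l, r) \<in> set L" "(l', r') \<in> set (translate_length a k ?code (l, r))" for l r l' r'
    proof -
      have comm: "replicate n a @ [a] \<approx> a # replicate n a" for n
        using relator_cong.refl[OF power_in[of "Suc n"], of w] by (simp add: replicate_append_same)
      have "k * length (subst \<sigma> l) + (k * length (subst \<sigma> r) - k * length (subst \<sigma> l))
          = k * length (subst \<sigma> r)"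
        using sL[OF e(1)] by simp
      then have "subst \<tau> [length_var l r, excess_var l r] = replicate (k * length (subst \<sigma> r)) a"
        by (simp add: \<tau>_simps flip: replicate_add)
      then have "subst \<tau> (length_var l r # excess_var l r # translate ?code r) \<approx> []"
        using ann[OF sub_in[OF el(2)[OF disjI2[OF e(1)]]]] by (simp add: tr flip: append_assoc)
      moreover have "subst \<tau> (length_var l r # translate ?code l) \<approx> []"
        using ann[OF sub_in[OF el(1)[OF disjI2[OF e(1)]]]] by (simp add: tr \<tau>_simps)
      ultimately show ?thesis
        using e(2) cond comm by (auto simp: commute_eq_def \<tau>_simps)
    qed
    ultimately have "\<forall>(l, r)\<in>set ?T. subst \<tau> l \<approx> subst \<tau> r"
      unfolding translate_system_def by fastforce
    then show "system_solvable A w ?T"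
      using system_solvable_iff[OF w_in T] \<tau>_in by blast
  qed
qed

end

text \<open>The empty alphabet is treated apart, as there is no letter to replace the superfluous blocks by;
  over it every system is solvable.\<close>

lemma word_equations_decidable_of_diophantine:
  assumes w: "w \<in> lists A" and ov: "overlap_conditions (minimal_pieces A w)"
    and dec: "diophantine_problem_decidable A w"
  shows "word_equations_with_length_decidable"
  unfolding word_equations_with_length_decidable_def
proof (intro allI impI)
  fix S :: "nat set" assume S: "finite S"
  obtain a where "overlapping_pieces A w a"
    using w ov by (auto simp: overlap_conditions_def overlapping_pieces_def
        nonoverlapping_pieces_def overlapping_pieces_axioms_def)
  then interpret overlapping_pieces A w a .
  obtain x y where xy: "x \<in> G" "y \<in> G" "x \<noteq> y" by (rule two_pieces)
  obtain f where f: "recursive f"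
    "\<And>E. E \<in> systems_over A \<Longrightarrow> f (encode_system E) = (if system_solvable A w E then 1 else 0)"
    using dec by (auto simp: diophantine_problem_decidable_def decidable_problem_def)
  let ?enc = "\<lambda>(E, L). prod_encode (encode_system E, encode_system L)"
  show "decidable_problem ?enc (systems_over S \<times> systems_over S) (length_system_solvable S)"
  proof (cases "S = {}")
    case True
    have "subst (\<lambda>_. []) t = []" if "t \<in> terms_over {}" for t
      using that by (induction t) auto
    then have "length_system_solvable S (E, L)" if "E \<in> systems_over S" "L \<in> systems_over S" for E L
      using that True unfolding length_system_solvable_def systems_over_def
      by (auto intro!: exI[of _ "\<lambda>_. []"])
    then show ?thesis
      unfolding decidable_problem_def using recursive_const[of 1] by fastforce
  next
    case False
    obtain c where c: "inj_on c S" "c ` S \<subseteq> blocks G (card S)"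
      using exists_block_code[OF S xy] .
    have k: "card S > 0" using S False by (simp add: card_gt_0_iff)
    let ?T = "translate_system a (card S) (\<lambda>s. \<Phi> (c s))"
    obtain F where F: "recursive F" "\<And>E L. E \<in> systems_over S \<Longrightarrow> L \<in> systems_over S \<Longrightarrow>
        F (prod_encode (encode_system E, encode_system L)) = encode_system (?T E L)"
      using recursive_translate_system[OF S] by blast
    have "f (F (?enc (E, L))) = (if length_system_solvable S (E, L) then 1 else 0)"
      if "E \<in> systems_over S" "L \<in> systems_over S" for E L
    proof -
      have "\<Phi> (c s) \<in> lists A" if "s \<in> S" for s
        using c(2) that by (intro \<Phi>_in) (auto simp: blocks_def)
      then have "?T E L \<in> systems_over A"
        by (intro translate_system_in[OF a_in _ that])
      then show ?thesis
        using f(2) F(2)[OF that] translate_system_solvable_iff[OF c k False that] by simp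
    qed
    then show ?thesis
      unfolding decidable_problem_def using recursive.comp[OF f(1) F(1)] by (intro exI[of _ "\<lambda>n. f (F n)"]) auto
  qed
qed

section \<open>A monoid with torsion satisfying the overlap conditions\<close>

lemma (in monoid) Units_left_factor:
  assumes "y \<in> Units G" "x \<otimes> y \<in> Units G" "x \<in> carrier G"
  shows "x \<in> Units G"
proof -
  have "x = (x \<otimes> y) \<otimes> inv y" using assms by (simp add: m_assoc Units_closed)
  then show ?thesis using assms by (metis Units_inv_Units Units_m_closed)
qed

text \<open>The word \<open>ab ac ab\<close>, with \<open>a\<close>, \<open>b\<close>, \<open>c\<close> named 0, 1, 2. As \<open>ab\<close> is both a prefix and a suffix of it, \<open>ab\<close> becomes
  invertible and then so does \<open>ac\<close>.\<close>

definition torsion_base :: word where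
  "torsion_base = [0, 1, 0, 2, 0, 1]"

text \<open>An action on the natural numbers in which \<open>a\<close> is the predecessor and the other letters are the
  successor. The relator acts trivially since \<open>ab\<close> and \<open>ac\<close> do, but \<open>a\<close> acts as a map that is not
  injective, so it has no left inverse.\<close>

definition counter :: "word \<Rightarrow> nat \<Rightarrow> nat" where
  "counter = foldr (\<lambda>c n. if c = 0 then n - 1 else Suc n)"

lemma counter_cong:
  "(u, v) \<in> relator_cong A (word_power torsion_base 2) \<Longrightarrow> counter u = counter v"
proof (induction rule: relator_cong.induct)
  case relator
  show ?case by (rule ext) (simp add: counter_def word_power_def torsion_base_def numeral_2_eq_2)
qed (auto simp: counter_def)

lemma minimal_pieces_torsion_example:
  "minimal_pieces {0, 1, 2} (word_power torsion_base 2) = {[0, 1], [0, 2]}"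
proof -
  let ?A = "{0, 1, 2} :: nat set" and ?w = "word_power torsion_base 2"
  let ?cls = "represented ?A ?w"
  let ?rs = "[[0, 1], [0, 2], [0, 1], [0, 1], [0, 2], [0, 1]] :: word list"
  have w_eq: "?w = concat ?rs" by (simp add: word_power_def torsion_base_def numeral_2_eq_2)
  have w: "?w \<in> lists ?A" by (simp add: w_eq)
  interpret M: monoid "one_relator_monoid ?A ?w" by (rule monoid_one_relator_monoid[OF w])
  let ?U = "Units (one_relator_monoid ?A ?w)"
  note mult = mult_represented[OF w]
  have prod: "?cls x \<otimes>\<^bsub>one_relator_monoid ?A ?w\<^esub> ?cls y \<in> ?U"
    if "x @ y = ?w" "x \<in> lists ?A" "y \<in> lists ?A" for x y
  proof -
    have "?cls ?w = \<one>\<^bsub>one_relator_monoid ?A ?w\<^esub>"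
      using represented_eq_iff[OF w w lists.Nil] relator_cong.relator[of ?w ?A]
      by (simp only: one_one_relator_monoid)
    then show ?thesis using mult[OF that(2,3)] that(1) M.Units_one_closed by (simp only:)
  qed
  have closed: "?cls x \<in> carrier (one_relator_monoid ?A ?w)" if "x \<in> lists ?A" for x
    using that by (rule represented_in_carrier)
  have ab: "?cls [0, 1] \<in> ?U"
    by (rule M.Units_middle[of "?cls [0, 1, 0, 2, 0, 1, 0, 1, 0, 2]" _ "?cls [0, 2, 0, 1, 0, 1, 0, 2, 0, 1]"];
        (rule prod closed)?) (simp_all add: w_eq)
  have "?cls [0, 2, 0, 1, 0, 1, 0, 2, 0, 1] \<in> ?U"
    by (rule M.Units_right_factor[OF ab]; (rule prod closed)?) (simp_all add: w_eq)
  moreover have "?cls [0, 1, 0, 2, 0, 1, 0, 1, 0, 2] \<in> ?U"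
    by (rule M.Units_left_factor[OF ab]; (rule prod closed)?) (simp_all add: w_eq)
  ultimately have ac: "?cls [0, 2] \<in> ?U"
    using M.Units_middle[of "?cls [0, 1, 0, 2, 0, 1, 0, 1]" "?cls [0, 2]" "?cls [0, 1, 0, 1, 0, 2, 0, 1]"]
    by (simp add: mult closed del: One_nat_def)
  have a: "?cls [0] \<notin> ?U"
  proof
    assume "?cls [0] \<in> ?U"
    then obtain y where "y \<in> carrier (one_relator_monoid ?A ?w)"
        "y \<otimes>\<^bsub>one_relator_monoid ?A ?w\<^esub> ?cls [0] = \<one>\<^bsub>one_relator_monoid ?A ?w\<^esub>"
      unfolding Units_def by blast
    then obtain x where x: "x \<in> lists ?A" "?cls (x @ [0]) = ?cls []"
      using mult by (elim carrier_one_relator_monoidE) (simp add: one_one_relator_monoid)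
    then have "(x @ [0], []) \<in> relator_cong ?A ?w" using represented_eq_iff[OF w] by simp
    from counter_cong[OF this] have "counter x (n - 1) = n" for n
      by (simp add: counter_def fun_eq_iff)
    \<comment> \<open>Truncated subtraction sends 0 and 1 to the same number.\<close>
    from this[of 0] this[of 1] show False by simp
  qed
  have "p = [0]" if "strict_prefix p [0, y]" "p \<noteq> []" for p and y :: nat
    using that by (auto simp: strict_prefix_def prefix_Cons)
  then have "minimal_invertible ?A ?w r" if "r \<in> set ?rs" for r
    using that ab ac a by (auto simp: minimal_invertible_def invertible_def)
  then have "(THE rs. concat rs = ?w \<and> (\<forall>r\<in>set rs. minimal_invertible ?A ?w r)) = ?rs"
    using w_eq by (intro the1_equality[OF relator_decomposition[OF w]]) simp
  then have "minimal_pieces ?A ?w = set ?rs" by (simp only: minimal_pieces_def)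
  then show ?thesis by auto
qed

lemma overlap_conditions_torsion_example: "overlap_conditions {[0, 1], [0, 2]}"
proof -
  have "\<not> strict_sublist u v" if "length u = length v" for u v :: word
    using that by (auto simp: strict_sublist_def sublist_def)
  then have "C1 {[0, 1], [0, 2]}" by (auto simp: C1_def)
  moreover have "C2 {[0, 1], [0, 2]} 0" "C3 {[0, 1], [0, 2]} 0" by (auto simp: C2_def C3_def)
  ultimately show ?thesis by (auto simp: overlap_conditions_def)
qed

theorem corollary3:
  shows "(\<not> word_equations_with_length_decidable \<longrightarrow>
            (\<forall>A w. finite A \<longrightarrow> w \<in> lists A \<longrightarrow> overlap_conditions (minimal_pieces A w) \<longrightarrow>
               \<not> diophantine_problem_decidable A w))
       \<and> ((\<exists>A w. finite A \<and> w \<in> lists A \<and> overlap_conditions (minimal_pieces A w) \<and>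
               diophantine_problem_decidable A w) \<longrightarrow>
            word_equations_with_length_decidable)
       \<and> ((\<forall>A w n. finite A \<longrightarrow> w \<in> lists A \<longrightarrow> w \<noteq> [] \<longrightarrow> n > 1 \<longrightarrow>
               diophantine_problem_decidable A (word_power w n)) \<longrightarrow>
            word_equations_with_length_decidable)"
proof (intro conjI impI)
  assume *: "\<forall>A w n. finite A \<longrightarrow> w \<in> lists A \<longrightarrow> w \<noteq> [] \<longrightarrow> n > 1 \<longrightarrow>
    diophantine_problem_decidable A (word_power w n)"
  have "diophantine_problem_decidable {0, 1, 2} (word_power torsion_base 2)"
    by (rule *[rule_format]) (simp_all add: torsion_base_def)
  then show "word_equations_with_length_decidable"
  proof (rule word_equations_decidable_of_diophantine[rotated 2])
    show "word_power torsion_base 2 \<in> lists {0, 1, 2}"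
      by (simp add: word_power_def torsion_base_def numeral_2_eq_2)
    show "overlap_conditions (minimal_pieces {0, 1, 2} (word_power torsion_base 2))"
      unfolding minimal_pieces_torsion_example by (rule overlap_conditions_torsion_example)
  qed
qed (use word_equations_decidable_of_diophantine in blast)+

end
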